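(* Let $R$ be a commutative ring and let $\mathcal{D}$ be an additive $R$-linear category. Assume that $\mathcal{D}$ has weak kernels and that $\mathrm{mod}\text{-}\mathcal{D}$ is Frobenius. Let $M:\mathcal{D}\to\mathrm{Mod}\text{-}R$ be a contravariant functor. If $M$ is weak right exact, then $M$ is isomorphic to a direct summand of a representable functor if and only if $M$ is finitely presented. If, in addition, $\mathcal{D}$ is karoubian, then $M$ is representable if and only if $M$ is finitely presented.
   Context: All functors are $R$-linear. $\mathcal{D}$ has weak kernels if for every $Y\to Z$ in $\mathcal{D}$ there is $X\to Y$ such that $\mathcal{D}(-,X)\to\mathcal{D}(-,Y)\to\mathcal{D}(-,Z)$ is exact; then $X\to Y\to Z$ is called a weak kernel sequence. A contravariant functor $M:\mathcal{D}\to\mathrm{Mod}\text{-}R$ is weak right exact if $M(Z)\to M(Y)\to M(X)$ is exact for every weak kernel sequence $X\to Y\to Z$. $M$ is finitely presented if there is an exact sequence $\mathcal{D}(-,C)\to\mathcal{D}(-,D)\to M\to0$ with $C,D\in\mathcal{D}$. $\mathrm{mod}\text{-}\mathcal{D}$ is the category of finitely presented contravariant functors $\mathcal{D}\to\mathrm{Mod}\text{-}R$ with natural transformations; it is abelian when $\mathcal{D}$ has weak kernels. An abelian category is called Frobenius if its projective objects and its injective objects coincide. $M$ is representable if $M\cong\mathcal{D}(-,X)$ for some $X\in\mathcal{D}$. A category is karoubian if every idempotent endomorphism splits. *)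

theory Defs
  imports "HOL-Algebra.Module" "HOL-Algebra.AbelCoset"
begin

section \<open>Linear maps and exactness\<close>

definition linear_map ::
  "('r, 'x) ring_scheme \<Rightarrow> ('r, 'm) module \<Rightarrow> ('r, 'n) module \<Rightarrow> ('m \<Rightarrow> 'n) \<Rightarrow> bool" where
  "linear_map R A B f \<longleftrightarrow>
     f \<in> carrier A \<rightarrow> carrier B \<and>
     (\<forall>x\<in>carrier A. \<forall>y\<in>carrier A. f (x \<oplus>\<^bsub>A\<^esub> y) = f x \<oplus>\<^bsub>B\<^esub> f y) \<and>
     (\<forall>r\<in>carrier R. \<forall>x\<in>carrier A. f (r \<odot>\<^bsub>A\<^esub> x) = r \<odot>\<^bsub>B\<^esub> f x)"

text \<open>Exactness of \<open>A \<rightarrow> B \<rightarrow> C\<close> (maps \<open>f\<close>, \<open>g\<close>) at \<open>B\<close>.\<close>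

definition exact_at ::
  "('r, 'l) module \<Rightarrow> ('r, 'm) module \<Rightarrow> ('r, 'n) module \<Rightarrow> ('l \<Rightarrow> 'm) \<Rightarrow> ('m \<Rightarrow> 'n) \<Rightarrow> bool" where
  "exact_at A B C f g \<longleftrightarrow> f ` carrier A = a_kernel B C g"


section \<open>Linear categories\<close>

text \<open>
  Composition is indexed by source, middle and target: \<open>Comp C X Y Z g f\<close> is \<open>g\<close> after \<open>f\<close> for
  \<open>f : X \<rightarrow> Y\<close> and \<open>g : Y \<rightarrow> Z\<close>. Hence distinct hom-modules need not be disjoint.
  The fields \<open>mult\<close> and \<open>one\<close> that a record of type \<open>module\<close> inherits from \<open>ring\<close> play no role.
\<close>

record ('o, 'a, 'r) lin_cat =
  Obj :: "'o set"
  Hom :: "'o \<Rightarrow> 'o \<Rightarrow> ('r, 'a) module"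
  Comp :: "'o \<Rightarrow> 'o \<Rightarrow> 'o \<Rightarrow> 'a \<Rightarrow> 'a \<Rightarrow> 'a"
  Ident :: "'o \<Rightarrow> 'a"

abbreviation Arr :: "('o, 'a, 'r) lin_cat \<Rightarrow> 'o \<Rightarrow> 'o \<Rightarrow> 'a set" where
  "Arr C X Y \<equiv> carrier (Hom C X Y)"

abbreviation Zero :: "('o, 'a, 'r) lin_cat \<Rightarrow> 'o \<Rightarrow> 'o \<Rightarrow> 'a" where
  "Zero C X Y \<equiv> \<zero>\<^bsub>Hom C X Y\<^esub>"

locale linear_category = cring R
  for R :: "('r, 'x) ring_scheme" and C :: "('o, 'a, 'r) lin_cat" +
  assumes Hom_module: "\<lbrakk>X \<in> Obj C; Y \<in> Obj C\<rbrakk> \<Longrightarrow> module R (Hom C X Y)"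
    and Ident_closed: "X \<in> Obj C \<Longrightarrow> Ident C X \<in> Arr C X X"
    and Comp_linear_left:
      "\<lbrakk>X \<in> Obj C; Y \<in> Obj C; Z \<in> Obj C; f \<in> Arr C X Y\<rbrakk>
        \<Longrightarrow> linear_map R (Hom C Y Z) (Hom C X Z) (\<lambda>g. Comp C X Y Z g f)"
    and Comp_linear_right:
      "\<lbrakk>X \<in> Obj C; Y \<in> Obj C; Z \<in> Obj C; g \<in> Arr C Y Z\<rbrakk>
        \<Longrightarrow> linear_map R (Hom C X Y) (Hom C X Z) (\<lambda>f. Comp C X Y Z g f)"
    and Comp_Ident_left:
      "\<lbrakk>X \<in> Obj C; Y \<in> Obj C; f \<in> Arr C X Y\<rbrakk> \<Longrightarrow> Comp C X Y Y (Ident C Y) f = f"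
    and Comp_Ident_right:
      "\<lbrakk>X \<in> Obj C; Y \<in> Obj C; f \<in> Arr C X Y\<rbrakk> \<Longrightarrow> Comp C X X Y f (Ident C X) = f"
    and Comp_assoc:
      "\<lbrakk>W \<in> Obj C; X \<in> Obj C; Y \<in> Obj C; Z \<in> Obj C;
        f \<in> Arr C W X; g \<in> Arr C X Y; h \<in> Arr C Y Z\<rbrakk>
        \<Longrightarrow> Comp C W X Z (Comp C X Y Z h g) f = Comp C W Y Z h (Comp C W X Y g f)"

definition is_zero_object :: "('o, 'a, 'r) lin_cat \<Rightarrow> 'o \<Rightarrow> bool" where
  "is_zero_object C Z \<longleftrightarrow> Z \<in> Obj C \<and>
     (\<forall>X\<in>Obj C. (\<exists>!f. f \<in> Arr C X Z) \<and> (\<exists>!f. f \<in> Arr C Z X))"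

definition is_biproduct ::
  "('o, 'a, 'r) lin_cat \<Rightarrow> 'o \<Rightarrow> 'o \<Rightarrow> 'o \<Rightarrow> 'a \<Rightarrow> 'a \<Rightarrow> 'a \<Rightarrow> 'a \<Rightarrow> bool" where
  "is_biproduct C X Y P i j p q \<longleftrightarrow> P \<in> Obj C \<and>
     i \<in> Arr C X P \<and> j \<in> Arr C Y P \<and> p \<in> Arr C P X \<and> q \<in> Arr C P Y \<and>
     Comp C X P X p i = Ident C X \<and> Comp C Y P Y q j = Ident C Y \<and>
     Comp C X P Y q i = Zero C X Y \<and> Comp C Y P X p j = Zero C Y X \<and>
     Comp C P X P i p \<oplus>\<^bsub>Hom C P P\<^esub> Comp C P Y P j q = Ident C P"

locale additive_category = linear_category +
  assumes zero_object_exists: "\<exists>Z. is_zero_object C Z"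
    and biproduct_exists:
      "\<lbrakk>X \<in> Obj C; Y \<in> Obj C\<rbrakk> \<Longrightarrow> \<exists>P i j p q. is_biproduct C X Y P i j p q"

definition is_mono :: "('o, 'a, 'r) lin_cat \<Rightarrow> 'o \<Rightarrow> 'o \<Rightarrow> 'a \<Rightarrow> bool" where
  "is_mono C X Y f \<longleftrightarrow> f \<in> Arr C X Y \<and>
     (\<forall>W\<in>Obj C. \<forall>g\<in>Arr C W X. \<forall>h\<in>Arr C W X. Comp C W X Y f g = Comp C W X Y f h \<longrightarrow> g = h)"

definition is_epi :: "('o, 'a, 'r) lin_cat \<Rightarrow> 'o \<Rightarrow> 'o \<Rightarrow> 'a \<Rightarrow> bool" where
  "is_epi C X Y f \<longleftrightarrow> f \<in> Arr C X Y \<and>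
     (\<forall>Z\<in>Obj C. \<forall>g\<in>Arr C Y Z. \<forall>h\<in>Arr C Y Z. Comp C X Y Z g f = Comp C X Y Z h f \<longrightarrow> g = h)"

definition is_kernel :: "('o, 'a, 'r) lin_cat \<Rightarrow> 'o \<Rightarrow> 'o \<Rightarrow> 'a \<Rightarrow> 'o \<Rightarrow> 'a \<Rightarrow> bool" where
  "is_kernel C X Y f K k \<longleftrightarrow> K \<in> Obj C \<and> k \<in> Arr C K X \<and> Comp C K X Y f k = Zero C K Y \<and>
     (\<forall>W\<in>Obj C. \<forall>g\<in>Arr C W X. Comp C W X Y f g = Zero C W Y \<longrightarrow>
        (\<exists>!h. h \<in> Arr C W K \<and> Comp C W K X k h = g))"

definition is_cokernel :: "('o, 'a, 'r) lin_cat \<Rightarrow> 'o \<Rightarrow> 'o \<Rightarrow> 'a \<Rightarrow> 'o \<Rightarrow> 'a \<Rightarrow> bool" where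
  "is_cokernel C X Y f Q q \<longleftrightarrow> Q \<in> Obj C \<and> q \<in> Arr C Y Q \<and> Comp C X Y Q q f = Zero C X Q \<and>
     (\<forall>Z\<in>Obj C. \<forall>g\<in>Arr C Y Z. Comp C X Y Z g f = Zero C X Z \<longrightarrow>
        (\<exists>!h. h \<in> Arr C Q Z \<and> Comp C Y Q Z h q = g))"

locale abelian_category = additive_category +
  assumes kernel_exists:
      "\<lbrakk>X \<in> Obj C; Y \<in> Obj C; f \<in> Arr C X Y\<rbrakk> \<Longrightarrow> \<exists>K k. is_kernel C X Y f K k"
    and cokernel_exists:
      "\<lbrakk>X \<in> Obj C; Y \<in> Obj C; f \<in> Arr C X Y\<rbrakk> \<Longrightarrow> \<exists>Q q. is_cokernel C X Y f Q q"
    and mono_is_kernel: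
      "\<lbrakk>X \<in> Obj C; Y \<in> Obj C; is_mono C X Y f\<rbrakk>
        \<Longrightarrow> \<exists>Z\<in>Obj C. \<exists>g\<in>Arr C Y Z. is_kernel C Y Z g X f"
    and epi_is_cokernel:
      "\<lbrakk>X \<in> Obj C; Y \<in> Obj C; is_epi C X Y f\<rbrakk>
        \<Longrightarrow> \<exists>W\<in>Obj C. \<exists>g\<in>Arr C W X. is_cokernel C W X g Y f"

definition is_projective :: "('o, 'a, 'r) lin_cat \<Rightarrow> 'o \<Rightarrow> bool" where
  "is_projective C P \<longleftrightarrow> P \<in> Obj C \<and>
     (\<forall>A\<in>Obj C. \<forall>B\<in>Obj C. \<forall>f g. is_epi C A B f \<and> g \<in> Arr C P B \<longrightarrow>
        (\<exists>h\<in>Arr C P A. Comp C P A B f h = g))"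

definition is_injective :: "('o, 'a, 'r) lin_cat \<Rightarrow> 'o \<Rightarrow> bool" where
  "is_injective C I \<longleftrightarrow> I \<in> Obj C \<and>
     (\<forall>A\<in>Obj C. \<forall>B\<in>Obj C. \<forall>f g. is_mono C A B f \<and> g \<in> Arr C A I \<longrightarrow>
        (\<exists>h\<in>Arr C B I. Comp C A B I h f = g))"

locale frobenius_category = abelian_category +
  assumes projective_iff_injective: "X \<in> Obj C \<Longrightarrow> is_projective C X \<longleftrightarrow> is_injective C X"

definition karoubian :: "('o, 'a, 'r) lin_cat \<Rightarrow> bool" where
  "karoubian C \<longleftrightarrow>
     (\<forall>X\<in>Obj C. \<forall>e\<in>Arr C X X. Comp C X X X e e = e \<longrightarrow>
        (\<exists>Y\<in>Obj C. \<exists>p\<in>Arr C X Y. \<exists>i\<in>Arr C Y X.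
           Comp C X Y X i p = e \<and> Comp C Y X Y p i = Ident C Y))"

text \<open>A weak kernel sequence \<open>X \<rightarrow> Y \<rightarrow> Z\<close> with first map \<open>g\<close> and second map \<open>f\<close>.\<close>

definition weak_kernel_seq ::
  "('o, 'a, 'r) lin_cat \<Rightarrow> 'o \<Rightarrow> 'o \<Rightarrow> 'o \<Rightarrow> 'a \<Rightarrow> 'a \<Rightarrow> bool" where
  "weak_kernel_seq C X Y Z g f \<longleftrightarrow>
     X \<in> Obj C \<and> Y \<in> Obj C \<and> Z \<in> Obj C \<and> g \<in> Arr C X Y \<and> f \<in> Arr C Y Z \<and>
     (\<forall>W\<in>Obj C. exact_at (Hom C W X) (Hom C W Y) (Hom C W Z)
        (\<lambda>h. Comp C W X Y g h) (\<lambda>h. Comp C W Y Z f h))"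

definition has_weak_kernels :: "('o, 'a, 'r) lin_cat \<Rightarrow> bool" where
  "has_weak_kernels C \<longleftrightarrow>
     (\<forall>Y\<in>Obj C. \<forall>Z\<in>Obj C. \<forall>f\<in>Arr C Y Z. \<exists>X g. weak_kernel_seq C X Y Z g f)"


section \<open>Contravariant functors to modules\<close>

text \<open>For \<open>f : X \<rightarrow> Y\<close> the map \<open>FMap M X Y f\<close> goes from \<open>FOb M Y\<close> to \<open>FOb M X\<close>.\<close>

record ('o, 'a, 'r, 'm) mod_functor =
  FOb :: "'o \<Rightarrow> ('r, 'm) module"
  FMap :: "'o \<Rightarrow> 'o \<Rightarrow> 'a \<Rightarrow> 'm \<Rightarrow> 'm"

locale contravariant_functor = linear_category R D
  for R :: "('r, 'x) ring_scheme" and D :: "('o, 'a, 'r) lin_cat" +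
  fixes M :: "('o, 'a, 'r, 'm) mod_functor"
  assumes FOb_module: "X \<in> Obj D \<Longrightarrow> module R (FOb M X)"
    and FMap_linear:
      "\<lbrakk>X \<in> Obj D; Y \<in> Obj D; f \<in> Arr D X Y\<rbrakk> \<Longrightarrow> linear_map R (FOb M Y) (FOb M X) (FMap M X Y f)"
    and FMap_Ident:
      "\<lbrakk>X \<in> Obj D; m \<in> carrier (FOb M X)\<rbrakk> \<Longrightarrow> FMap M X X (Ident D X) m = m"
    and FMap_Comp:
      "\<lbrakk>X \<in> Obj D; Y \<in> Obj D; Z \<in> Obj D; f \<in> Arr D X Y; g \<in> Arr D Y Z; m \<in> carrier (FOb M Z)\<rbrakk>
        \<Longrightarrow> FMap M X Z (Comp D X Y Z g f) m = FMap M X Y f (FMap M Y Z g m)"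
    and functor_linear:
      "\<lbrakk>X \<in> Obj D; Y \<in> Obj D; m \<in> carrier (FOb M Y)\<rbrakk>
        \<Longrightarrow> linear_map R (Hom D X Y) (FOb M X) (\<lambda>f. FMap M X Y f m)"

definition hom_functor :: "('o, 'a, 'r) lin_cat \<Rightarrow> 'o \<Rightarrow> ('o, 'a, 'r, 'a) mod_functor" where
  "hom_functor D Z =
     \<lparr>FOb = (\<lambda>X. Hom D X Z), FMap = (\<lambda>X Y f g. Comp D X Y Z g f)\<rparr>"

definition nat_trans ::
  "('r, 'x) ring_scheme \<Rightarrow> ('o, 'a, 'r) lin_cat \<Rightarrow>
   ('o, 'a, 'r, 'm) mod_functor \<Rightarrow> ('o, 'a, 'r, 'n) mod_functor \<Rightarrow> ('o \<Rightarrow> 'm \<Rightarrow> 'n) \<Rightarrow> bool" where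
  "nat_trans R D F G \<eta> \<longleftrightarrow>
     (\<forall>X\<in>Obj D. linear_map R (FOb F X) (FOb G X) (\<eta> X)) \<and>
     (\<forall>X\<in>Obj D. \<forall>Y\<in>Obj D. \<forall>f\<in>Arr D X Y. \<forall>m\<in>carrier (FOb F Y).
        \<eta> X (FMap F X Y f m) = FMap G X Y f (\<eta> Y m))"

definition functor_iso ::
  "('r, 'x) ring_scheme \<Rightarrow> ('o, 'a, 'r) lin_cat \<Rightarrow>
   ('o, 'a, 'r, 'm) mod_functor \<Rightarrow> ('o, 'a, 'r, 'n) mod_functor \<Rightarrow> bool" where
  "functor_iso R D F G \<longleftrightarrow>
     (\<exists>\<eta>. nat_trans R D F G \<eta> \<and>
        (\<forall>X\<in>Obj D. bij_betw (\<eta> X) (carrier (FOb F X)) (carrier (FOb G X))))"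

definition representable ::
  "('r, 'x) ring_scheme \<Rightarrow> ('o, 'a, 'r) lin_cat \<Rightarrow> ('o, 'a, 'r, 'm) mod_functor \<Rightarrow> bool" where
  "representable R D M \<longleftrightarrow> (\<exists>X\<in>Obj D. functor_iso R D M (hom_functor D X))"

definition finitely_presented ::
  "('r, 'x) ring_scheme \<Rightarrow> ('o, 'a, 'r) lin_cat \<Rightarrow> ('o, 'a, 'r, 'm) mod_functor \<Rightarrow> bool" where
  "finitely_presented R D M \<longleftrightarrow>
     (\<exists>A\<in>Obj D. \<exists>B\<in>Obj D. \<exists>\<alpha> \<beta>.
        nat_trans R D (hom_functor D A) (hom_functor D B) \<alpha> \<and>
        nat_trans R D (hom_functor D B) M \<beta> \<and>
        (\<forall>X\<in>Obj D. exact_at (Hom D X A) (Hom D X B) (FOb M X) (\<alpha> X) (\<beta> X) \<and>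
           \<beta> X ` Arr D X B = carrier (FOb M X)))"

definition weak_right_exact ::
  "('o, 'a, 'r) lin_cat \<Rightarrow> ('o, 'a, 'r, 'm) mod_functor \<Rightarrow> bool" where
  "weak_right_exact D M \<longleftrightarrow>
     (\<forall>X Y Z g f. weak_kernel_seq D X Y Z g f \<longrightarrow>
        exact_at (FOb M Z) (FOb M Y) (FOb M X) (FMap M Y Z f) (FMap M X Y g))"

definition is_subfunctor ::
  "('r, 'x) ring_scheme \<Rightarrow> ('o, 'a, 'r) lin_cat \<Rightarrow> ('o, 'a, 'r, 'm) mod_functor \<Rightarrow>
   ('o \<Rightarrow> 'm set) \<Rightarrow> bool" where
  "is_subfunctor R D F S \<longleftrightarrow>
     (\<forall>X\<in>Obj D. submodule (S X) R (FOb F X)) \<and>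
     (\<forall>X\<in>Obj D. \<forall>Y\<in>Obj D. \<forall>f\<in>Arr D X Y. FMap F X Y f ` S Y \<subseteq> S X)"

definition subfunctor :: "('o, 'a, 'r, 'm) mod_functor \<Rightarrow> ('o \<Rightarrow> 'm set) \<Rightarrow>
    ('o, 'a, 'r, 'm) mod_functor" where
  "subfunctor F S = F\<lparr>FOb := (\<lambda>X. (FOb F X)\<lparr>carrier := S X\<rparr>)\<rparr>"

definition is_direct_summand ::
  "('r, 'x) ring_scheme \<Rightarrow> ('o, 'a, 'r) lin_cat \<Rightarrow> ('o, 'a, 'r, 'm) mod_functor \<Rightarrow>
   ('o \<Rightarrow> 'm set) \<Rightarrow> bool" where
  "is_direct_summand R D F S \<longleftrightarrow> is_subfunctor R D F S \<and>
     (\<exists>T. is_subfunctor R D F T \<and>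
        (\<forall>X\<in>Obj D. S X \<inter> T X = {\<zero>\<^bsub>FOb F X\<^esub>} \<and> S X <+>\<^bsub>FOb F X\<^esub> T X = carrier (FOb F X)))"

definition iso_to_summand_of_representable ::
  "('r, 'x) ring_scheme \<Rightarrow> ('o, 'a, 'r) lin_cat \<Rightarrow> ('o, 'a, 'r, 'm) mod_functor \<Rightarrow> bool" where
  "iso_to_summand_of_representable R D M \<longleftrightarrow>
     (\<exists>X\<in>Obj D. \<exists>S. is_direct_summand R D (hom_functor D X) S \<and>
        functor_iso R D M (subfunctor (hom_functor D X) S))"


section \<open>The category of finitely presented functors\<close>

text \<open>
  A morphism \<open>F \<rightarrow> G\<close> is a natural transformation, made extensional so that equality of morphisms
  is equality of the components on the carriers. Hom-modules are formed pointwise.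
\<close>

definition nat_hom ::
  "('r, 'x) ring_scheme \<Rightarrow> ('o, 'a, 'r) lin_cat \<Rightarrow>
   ('o, 'a, 'r, 'm) mod_functor \<Rightarrow> ('o, 'a, 'r, 'm) mod_functor \<Rightarrow> ('r, 'o \<Rightarrow> 'm \<Rightarrow> 'm) module" where
  "nat_hom R D F G =
     \<lparr>carrier = {\<eta> \<in> (\<Pi>\<^sub>E X\<in>Obj D. carrier (FOb F X) \<rightarrow>\<^sub>E carrier (FOb G X)). nat_trans R D F G \<eta>},
      mult = undefined,
      one = undefined,
      zero = (\<lambda>X\<in>Obj D. \<lambda>x\<in>carrier (FOb F X). \<zero>\<^bsub>FOb G X\<^esub>),
      add = (\<lambda>\<eta> \<theta>. \<lambda>X\<in>Obj D. \<lambda>x\<in>carrier (FOb F X). \<eta> X x \<oplus>\<^bsub>FOb G X\<^esub> \<theta> X x),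
      smult = (\<lambda>r \<eta>. \<lambda>X\<in>Obj D. \<lambda>x\<in>carrier (FOb F X). r \<odot>\<^bsub>FOb G X\<^esub> \<eta> X x)\<rparr>"

text \<open>
  The objects of \<open>mod-D\<close> must take values in modules over one fixed type. Elements of type
  \<open>'a set\<close> suffice: if \<open>D(-,A) \<rightarrow> D(-,B) \<rightarrow> M \<rightarrow> 0\<close> is exact, then \<open>M(X)\<close> is isomorphic to the
  module of cosets in \<open>D(X,B)\<close> of the image of \<open>D(X,A)\<close>. So every finitely presented functor,
  whatever the type of its values, is isomorphic to an object of this category.
\<close>

definition mod_cat ::
  "('r, 'x) ring_scheme \<Rightarrow> ('o, 'a, 'r) lin_cat \<Rightarrow>
   (('o, 'a, 'r, 'a set) mod_functor, 'o \<Rightarrow> 'a set \<Rightarrow> 'a set, 'r) lin_cat" where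
  "mod_cat R D =
     \<lparr>Obj = {F. contravariant_functor R D F \<and> finitely_presented R D F},
      Hom = nat_hom R D,
      Comp = (\<lambda>F G H \<theta> \<eta>. \<lambda>X\<in>Obj D. \<lambda>x\<in>carrier (FOb F X). \<theta> X (\<eta> X x)),
      Ident = (\<lambda>F. \<lambda>X\<in>Obj D. \<lambda>x\<in>carrier (FOb F X). x)\<rparr>"

end

theory Submission
  imports Defs
begin

text \<open>
  Let \<open>M\<close> be finitely presented, with a pointwise surjective \<open>\<beta> : D(-,B) \<rightarrow> M\<close>. The point is that
  weak right exactness makes \<open>M\<close> an injective object of \<open>mod-D\<close>; in a Frobenius category \<open>M\<close> is then
  projective, so \<open>\<beta>\<close> has a section \<open>\<sigma>\<close>. The image of \<open>\<sigma>\<close> is a direct summand of \<open>D(-,B)\<close>, with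
  complement the kernel of \<open>\<beta>\<close>. If \<open>D\<close> is karoubian, split the idempotent \<open>e : B \<rightarrow> B\<close> that
  corresponds to \<open>\<sigma> \<beta>\<close> by Yoneda's lemma, as \<open>B \<rightarrow> Y \<rightarrow> B\<close>; then \<open>M\<close> is represented by \<open>Y\<close>.

  For injectivity (\<open>weak_right_exact_extension\<close>), let \<open>\<phi> : F \<rightarrow> G\<close> be a monomorphism and
  \<open>\<gamma> : F \<rightarrow> M\<close>. Choose a generator \<open>s \<in> F(E)\<close> and a presentation \<open>D(-,A) \<rightarrow> D(-,B) \<rightarrow> G \<rightarrow> 0\<close> whose
  first map is composition with \<open>a : A \<rightarrow> B\<close>, and lift \<open>\<phi>(s)\<close> to \<open>e : E \<rightarrow> B\<close>. By Yoneda's lemma an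
  extension of \<open>\<gamma>\<close> to \<open>G\<close> is an element \<open>n \<in> M(B)\<close> that restricts to \<open>0\<close> along \<open>a\<close> and to
  \<open>\<gamma>(s)\<close> along \<open>e\<close>, that is, to \<open>(0, \<gamma>(s)) \<in> M(A \<oplus> E)\<close> along \<open>(a, e) : A \<oplus> E \<rightarrow> B\<close>.
  Since \<open>M\<close> is weak right exact, such an \<open>n\<close> exists if \<open>(0, \<gamma>(s))\<close> vanishes on a weak kernel \<open>K\<close>
  of \<open>(a, e)\<close>. It does: if \<open>l : K \<rightarrow> E\<close> is the second component of \<open>K \<rightarrow> A \<oplus> E\<close>, then \<open>e l\<close>
  factors through \<open>a\<close> up to sign, so \<open>\<phi>\<close> maps the restriction of \<open>s\<close> along \<open>l\<close> to \<open>0\<close>, and \<open>\<phi>\<close>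
  is injective.

  The objects of \<open>mod-D\<close> have values in sets of arrows, so \<open>M\<close> and \<open>D(-,B)\<close> have to be replaced by
  isomorphic copies: an element of \<open>M(X)\<close> becomes its fibre under \<open>\<beta>\<close>, and an arrow \<open>x\<close> becomes \<open>{x}\<close>.
  The copies of the representable functors also detect that monomorphisms of \<open>mod-D\<close> are pointwise
  injective (\<open>mono_mod_cat_inj_on\<close>).

  Conversely, if \<open>D(-,B)\<close> is the direct sum of subfunctors \<open>S\<close> and \<open>T\<close>, write the identity of \<open>B\<close> as
  \<open>s + t\<close> with \<open>s \<in> S(B)\<close> and \<open>t \<in> T(B)\<close>; composition with \<open>t\<close> and with \<open>s\<close> presents \<open>S\<close>.
\<close>

section \<open>Linear maps\<close>

lemma linear_mapI:
  assumes "\<And>x. x \<in> carrier A \<Longrightarrow> f x \<in> carrier B"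
    and "\<And>x y. \<lbrakk>x \<in> carrier A; y \<in> carrier A\<rbrakk> \<Longrightarrow> f (x \<oplus>\<^bsub>A\<^esub> y) = f x \<oplus>\<^bsub>B\<^esub> f y"
    and "\<And>r x. \<lbrakk>r \<in> carrier R; x \<in> carrier A\<rbrakk> \<Longrightarrow> f (r \<odot>\<^bsub>A\<^esub> x) = r \<odot>\<^bsub>B\<^esub> f x"
  shows "linear_map R A B f"
  using assms by (auto simp: linear_map_def)

lemma linear_map_closed: "\<lbrakk>linear_map R A B f; x \<in> carrier A\<rbrakk> \<Longrightarrow> f x \<in> carrier B"
  by (auto simp: linear_map_def)

lemma linear_map_add:
  "\<lbrakk>linear_map R A B f; x \<in> carrier A; y \<in> carrier A\<rbrakk> \<Longrightarrow> f (x \<oplus>\<^bsub>A\<^esub> y) = f x \<oplus>\<^bsub>B\<^esub> f y"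
  by (auto simp: linear_map_def)

lemma linear_map_smult:
  "\<lbrakk>linear_map R A B f; r \<in> carrier R; x \<in> carrier A\<rbrakk> \<Longrightarrow> f (r \<odot>\<^bsub>A\<^esub> x) = r \<odot>\<^bsub>B\<^esub> f x"
  by (auto simp: linear_map_def)

lemma linear_map_zero:
  assumes "module R A" "module R B" "linear_map R A B f"
  shows "f \<zero>\<^bsub>A\<^esub> = \<zero>\<^bsub>B\<^esub>"
proof -
  interpret A: module R A by fact
  interpret B: module R B by fact
  have c: "f \<zero>\<^bsub>A\<^esub> \<in> carrier B" using linear_map_closed[OF assms(3)] by simp
  have "f \<zero>\<^bsub>A\<^esub> \<oplus>\<^bsub>B\<^esub> f \<zero>\<^bsub>A\<^esub> = f \<zero>\<^bsub>A\<^esub> \<oplus>\<^bsub>B\<^esub> \<zero>\<^bsub>B\<^esub>"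
    using linear_map_add[OF assms(3), of "\<zero>\<^bsub>A\<^esub>" "\<zero>\<^bsub>A\<^esub>"] c by simp
  then show ?thesis using c by (metis B.add.r_cancel_one' B.r_zero)
qed

lemma linear_map_minus:
  assumes "module R A" "module R B" "linear_map R A B f" "x \<in> carrier A" "y \<in> carrier A"
  shows "f (x \<ominus>\<^bsub>A\<^esub> y) = f x \<ominus>\<^bsub>B\<^esub> f y"
proof -
  interpret A: module R A by fact
  interpret B: module R B by fact
  note c = linear_map_closed[OF assms(3)]
  have "f (\<ominus>\<^bsub>A\<^esub> y) \<oplus>\<^bsub>B\<^esub> f y = \<zero>\<^bsub>B\<^esub>"
    using linear_map_add[OF assms(3), of "\<ominus>\<^bsub>A\<^esub> y" y] assms(5) linear_map_zero[OF assms(1-3)]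
    by (simp add: A.l_neg)
  then have "f (\<ominus>\<^bsub>A\<^esub> y) = \<ominus>\<^bsub>B\<^esub> f y"
    using c assms(5) by (metis A.a_inv_closed B.minus_equality)
  then show ?thesis
    using linear_map_add[OF assms(3), of x "\<ominus>\<^bsub>A\<^esub> y"] assms(4,5)
    by (simp add: A.minus_eq B.minus_eq)
qed

lemma linear_map_comp:
  "\<lbrakk>linear_map R A B f; linear_map R B C g\<rbrakk> \<Longrightarrow> linear_map R A C (\<lambda>x. g (f x))"
  by (auto simp: linear_map_def Pi_iff)

lemma linear_map_inv_into:
  assumes "module R A" "linear_map R A B f" "bij_betw f (carrier A) (carrier B)"
  shows "linear_map R B A (inv_into (carrier A) f)"
proof -
  interpret A: module R A by fact
  let ?g = "inv_into (carrier A) f"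
  have g: "?g y \<in> carrier A" "f (?g y) = y" if "y \<in> carrier B" for y
    using assms(3) that by (auto simp: bij_betw_def inv_into_into f_inv_into_f)
  have inv: "?g (f x) = x" if "x \<in> carrier A" for x
    using assms(3) that by (auto simp: bij_betw_def)
  show ?thesis
  proof (rule linear_mapI)
    fix x y assume "x \<in> carrier B" "y \<in> carrier B"
    then show "?g (x \<oplus>\<^bsub>B\<^esub> y) = ?g x \<oplus>\<^bsub>A\<^esub> ?g y"
      using inv[of "?g x \<oplus>\<^bsub>A\<^esub> ?g y"] g linear_map_add[OF assms(2), of "?g x" "?g y"] by simp
  next
    fix r x assume "r \<in> carrier R" "x \<in> carrier B"
    then show "?g (r \<odot>\<^bsub>B\<^esub> x) = r \<odot>\<^bsub>A\<^esub> ?g x"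
      using inv[of "r \<odot>\<^bsub>A\<^esub> ?g x"] g linear_map_smult[OF assms(2), of r "?g x"] by simp
  qed (use g in auto)
qed

lemma a_kernel_iff: "x \<in> a_kernel A B f \<longleftrightarrow> x \<in> carrier A \<and> f x = \<zero>\<^bsub>B\<^esub>"
  by (simp add: a_kernel_def kernel_def)


section \<open>Natural transformations and Yoneda's lemma\<close>

lemma nat_transI:
  assumes "\<And>X. X \<in> Obj D \<Longrightarrow> linear_map R (FOb F X) (FOb G X) (\<eta> X)"
    and "\<And>X Y f m. \<lbrakk>X \<in> Obj D; Y \<in> Obj D; f \<in> Arr D X Y; m \<in> carrier (FOb F Y)\<rbrakk>
      \<Longrightarrow> \<eta> X (FMap F X Y f m) = FMap G X Y f (\<eta> Y m)"
  shows "nat_trans R D F G \<eta>"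
  using assms by (auto simp: nat_trans_def)

lemma nat_trans_linear:
  "\<lbrakk>nat_trans R D F G \<eta>; X \<in> Obj D\<rbrakk> \<Longrightarrow> linear_map R (FOb F X) (FOb G X) (\<eta> X)"
  by (auto simp: nat_trans_def)

lemma nat_trans_closed:
  "\<lbrakk>nat_trans R D F G \<eta>; X \<in> Obj D; x \<in> carrier (FOb F X)\<rbrakk> \<Longrightarrow> \<eta> X x \<in> carrier (FOb G X)"
  by (blast intro: linear_map_closed nat_trans_linear)

lemma nat_trans_natural:
  "\<lbrakk>nat_trans R D F G \<eta>; X \<in> Obj D; Y \<in> Obj D; f \<in> Arr D X Y; m \<in> carrier (FOb F Y)\<rbrakk>
    \<Longrightarrow> \<eta> X (FMap F X Y f m) = FMap G X Y f (\<eta> Y m)"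
  by (auto simp: nat_trans_def)

lemma nat_trans_comp:
  assumes "nat_trans R D F G \<eta>" "nat_trans R D G H \<theta>"
  shows "nat_trans R D F H (\<lambda>X x. \<theta> X (\<eta> X x))"
proof (rule nat_transI)
  fix X assume "X \<in> Obj D"
  then show "linear_map R (FOb F X) (FOb H X) (\<lambda>x. \<theta> X (\<eta> X x))"
    using assms by (blast intro: linear_map_comp nat_trans_linear)
qed (use assms in \<open>simp add: nat_trans_natural nat_trans_closed\<close>)

lemma FOb_hom_functor [simp]: "FOb (hom_functor D Z) X = Hom D X Z"
  by (simp add: hom_functor_def)

lemma FMap_hom_functor [simp]: "FMap (hom_functor D Z) X Y f g = Comp D X Y Z g f"
  by (simp add: hom_functor_def)

context contravariant_functor
begin

lemma FMap_closed:
  "\<lbrakk>X \<in> Obj D; Y \<in> Obj D; f \<in> Arr D X Y; m \<in> carrier (FOb M Y)\<rbrakk>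
    \<Longrightarrow> FMap M X Y f m \<in> carrier (FOb M X)"
  by (blast intro: linear_map_closed FMap_linear)

lemma zero_FOb: "X \<in> Obj D \<Longrightarrow> \<zero>\<^bsub>FOb M X\<^esub> \<in> carrier (FOb M X)"
  using FOb_module by (meson abelian_group.axioms(1) abelian_monoid.zero_closed module.axioms(2))

lemma FMap_zero_arrow:
  "\<lbrakk>X \<in> Obj D; Y \<in> Obj D; m \<in> carrier (FOb M Y)\<rbrakk> \<Longrightarrow> FMap M X Y (Zero D X Y) m = \<zero>\<^bsub>FOb M X\<^esub>"
  by (rule linear_map_zero[OF Hom_module FOb_module functor_linear])

end

context linear_category
begin

lemma Comp_closed:
  "\<lbrakk>X \<in> Obj C; Y \<in> Obj C; Z \<in> Obj C; f \<in> Arr C X Y; g \<in> Arr C Y Z\<rbrakk> \<Longrightarrow> Comp C X Y Z g f \<in> Arr C X Z"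
  by (rule linear_map_closed[OF Comp_linear_left])

lemma hom_functor_contravariant:
  assumes "Z \<in> Obj C"
  shows "contravariant_functor R C (hom_functor C Z)"
  by (intro contravariant_functor.intro contravariant_functor_axioms.intro linear_category_axioms)
    (use assms in \<open>simp_all add: hom_functor_def Hom_module Comp_linear_left Comp_linear_right Comp_Ident_right Comp_assoc\<close>)

end

lemma (in contravariant_functor) yoneda_nat_trans:
  assumes "B \<in> Obj D" "n \<in> carrier (FOb M B)"
  shows "nat_trans R D (hom_functor D B) M (\<lambda>X x. FMap M X B x n)"
  by (rule nat_transI) (use assms in \<open>auto simp: functor_linear FMap_Comp\<close>)

lemma (in linear_category) yoneda_determined:
  assumes "nat_trans R C (hom_functor C B) M \<eta>" "B \<in> Obj C" "X \<in> Obj C" "x \<in> Arr C X B"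
  shows "\<eta> X x = FMap M X B x (\<eta> B (Ident C B))"
  using nat_trans_natural[OF assms(1,3,2,4), of "Ident C B"] assms
  by (simp add: Ident_closed Comp_Ident_left)

lemma nat_trans_zero:
  assumes "contravariant_functor R D F" "contravariant_functor R D G" "nat_trans R D F G \<eta>"
    and "X \<in> Obj D"
  shows "\<eta> X \<zero>\<^bsub>FOb F X\<^esub> = \<zero>\<^bsub>FOb G X\<^esub>"
  using assms by (intro linear_map_zero[where R = R] contravariant_functor.FOb_module nat_trans_linear)

text \<open>
  A map out of \<open>F\<close> that vanishes on the kernel of a surjection \<open>p : F \<rightarrow> G\<close> factors through \<open>G\<close>:
  its values do not depend on the chosen preimages under \<open>p\<close>.
\<close>

lemma nat_trans_descend:
  assumes F: "contravariant_functor R D F" and G: "contravariant_functor R D G"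
    and H: "contravariant_functor R D H"
    and p: "nat_trans R D F G p" and n: "nat_trans R D F H n"
    and surj: "\<And>X. X \<in> Obj D \<Longrightarrow> p X ` carrier (FOb F X) = carrier (FOb G X)"
    and ker: "\<And>X x. \<lbrakk>X \<in> Obj D; x \<in> carrier (FOb F X); p X x = \<zero>\<^bsub>FOb G X\<^esub>\<rbrakk>
      \<Longrightarrow> n X x = \<zero>\<^bsub>FOb H X\<^esub>"
  shows "\<exists>h. nat_trans R D G H h \<and> (\<forall>X\<in>Obj D. \<forall>x\<in>carrier (FOb F X). h X (p X x) = n X x)"
proof -
  define h where "h = (\<lambda>X y. n X (inv_into (carrier (FOb F X)) (p X) y))"
  have h: "h X (p X x) = n X x" if X: "X \<in> Obj D" and x: "x \<in> carrier (FOb F X)" for X x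
  proof -
    interpret F: module R "FOb F X" by (rule contravariant_functor.FOb_module[OF F X])
    interpret G: module R "FOb G X" by (rule contravariant_functor.FOb_module[OF G X])
    interpret H: module R "FOb H X" by (rule contravariant_functor.FOb_module[OF H X])
    define z where "z = inv_into (carrier (FOb F X)) (p X) (p X x)"
    have z: "z \<in> carrier (FOb F X)" "p X z = p X x"
      unfolding z_def using x by (auto intro: inv_into_into f_inv_into_f)
    have "p X (z \<ominus>\<^bsub>FOb F X\<^esub> x) = \<zero>\<^bsub>FOb G X\<^esub>"
      using linear_map_minus[OF F.module_axioms G.module_axioms nat_trans_linear[OF p X] z(1) x] z(2)
        nat_trans_closed[OF p X x] by (simp add: G.minus_eq G.r_neg)
    then have "n X z \<ominus>\<^bsub>FOb H X\<^esub> n X x = \<zero>\<^bsub>FOb H X\<^esub>"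
      using linear_map_minus[OF F.module_axioms H.module_axioms nat_trans_linear[OF n X] z(1) x]
        ker[OF X, of "z \<ominus>\<^bsub>FOb F X\<^esub> x"] z x by simp
    then have "n X z = n X x"
      using nat_trans_closed[OF n X] z(1) x H.minus_equality[of "n X z" "\<ominus>\<^bsub>FOb H X\<^esub> n X x"]
      by (simp add: H.minus_eq)
    then show ?thesis by (simp add: h_def z_def)
  qed
  have lift: "\<exists>x\<in>carrier (FOb F X). y = p X x" if "X \<in> Obj D" "y \<in> carrier (FOb G X)" for X y
    using surj[OF that(1)] that(2) by auto
  have "nat_trans R D G H h"
  proof (rule nat_transI)
    fix X assume X: "X \<in> Obj D"
    interpret F: module R "FOb F X" by (rule contravariant_functor.FOb_module[OF F X])
    note lp = nat_trans_linear[OF p X] and ln = nat_trans_linear[OF n X]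
    show "linear_map R (FOb G X) (FOb H X) (h X)"
    proof (rule linear_mapI)
      fix y assume "y \<in> carrier (FOb G X)"
      then show "h X y \<in> carrier (FOb H X)"
        using lift[OF X] h[OF X] nat_trans_closed[OF n X] by fastforce
    next
      fix y z assume "y \<in> carrier (FOb G X)" "z \<in> carrier (FOb G X)"
      then obtain u v where uv: "u \<in> carrier (FOb F X)" "y = p X u" "v \<in> carrier (FOb F X)" "z = p X v"
        using lift[OF X] by meson
      then show "h X (y \<oplus>\<^bsub>FOb G X\<^esub> z) = h X y \<oplus>\<^bsub>FOb H X\<^esub> h X z"
        using h[OF X, of "u \<oplus>\<^bsub>FOb F X\<^esub> v"] h[OF X]
        by (simp add: linear_map_add[OF lp] linear_map_add[OF ln])
    next
      fix r y assume r: "r \<in> carrier R" and "y \<in> carrier (FOb G X)"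
      then obtain u where "u \<in> carrier (FOb F X)" "y = p X u"
        using lift[OF X] by meson
      then show "h X (r \<odot>\<^bsub>FOb G X\<^esub> y) = r \<odot>\<^bsub>FOb H X\<^esub> h X y"
        using h[OF X, of "r \<odot>\<^bsub>FOb F X\<^esub> u"] h[OF X] r
        by (simp add: linear_map_smult[OF lp] linear_map_smult[OF ln])
    qed
  next
    fix X Y f y assume a: "X \<in> Obj D" "Y \<in> Obj D" "f \<in> Arr D X Y" and "y \<in> carrier (FOb G Y)"
    then obtain u where u: "u \<in> carrier (FOb F Y)" "y = p Y u"
      using lift by meson
    then show "h X (FMap G X Y f y) = FMap H X Y f (h Y y)"
      using h[OF a(1) contravariant_functor.FMap_closed[OF F a u(1)]] h[OF a(2) u(1)]
        nat_trans_natural[OF p a u(1)] nat_trans_natural[OF n a u(1)] by simp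
  qed
  then show ?thesis using h by blast
qed


section \<open>Isomorphic functors\<close>

lemma nat_trans_inverse:
  assumes F: "contravariant_functor R D F" and \<eta>: "nat_trans R D F G \<eta>"
    and bij: "\<And>X. X \<in> Obj D \<Longrightarrow> bij_betw (\<eta> X) (carrier (FOb F X)) (carrier (FOb G X))"
  shows "nat_trans R D G F (\<lambda>X. inv_into (carrier (FOb F X)) (\<eta> X))"
proof (rule nat_transI)
  fix X assume "X \<in> Obj D"
  then show "linear_map R (FOb G X) (FOb F X) (inv_into (carrier (FOb F X)) (\<eta> X))"
    using assms by (intro linear_map_inv_into contravariant_functor.FOb_module nat_trans_linear)
next
  fix X Y f y assume a: "X \<in> Obj D" "Y \<in> Obj D" "f \<in> Arr D X Y" and y: "y \<in> carrier (FOb G Y)"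
  then obtain u where u: "u \<in> carrier (FOb F Y)" "y = \<eta> Y u"
    using bij[of Y] by (auto simp: bij_betw_def)
  then show "inv_into (carrier (FOb F X)) (\<eta> X) (FMap G X Y f y) =
      FMap F X Y f (inv_into (carrier (FOb F Y)) (\<eta> Y) y)"
    using nat_trans_natural[OF \<eta> a u(1)] bij[of X] bij[of Y] a
      contravariant_functor.FMap_closed[OF F a u(1)]
    by (metis bij_betw_def inv_into_f_f)
qed

lemma functor_iso_sym:
  assumes "contravariant_functor R D F" "functor_iso R D F G"
  shows "functor_iso R D G F"
proof -
  obtain \<eta> where \<eta>: "nat_trans R D F G \<eta>"
    and bij: "\<And>X. X \<in> Obj D \<Longrightarrow> bij_betw (\<eta> X) (carrier (FOb F X)) (carrier (FOb G X))"
    using assms(2) by (auto simp: functor_iso_def)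
  then show ?thesis
    using nat_trans_inverse[OF assms(1) \<eta> bij] bij_betw_inv_into unfolding functor_iso_def by blast
qed

text \<open>
  Finite presentation and weak right exactness are invariant under isomorphism also when the two
  functors take values in different types. This is what permits passing between a functor and its copy
  in \<open>mod-D\<close>.
\<close>

lemma finitely_presented_iso:
  assumes F: "contravariant_functor R D F" and G: "contravariant_functor R D G"
    and iso: "functor_iso R D F G" and fp: "finitely_presented R D F"
  shows "finitely_presented R D G"
proof -
  obtain \<eta> where \<eta>: "nat_trans R D F G \<eta>"
    and bij: "\<And>X. X \<in> Obj D \<Longrightarrow> bij_betw (\<eta> X) (carrier (FOb F X)) (carrier (FOb G X))"
    using iso by (auto simp: functor_iso_def)
  obtain A B \<alpha> \<beta> where AB: "A \<in> Obj D" "B \<in> Obj D"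
    and \<alpha>: "nat_trans R D (hom_functor D A) (hom_functor D B) \<alpha>"
    and \<beta>: "nat_trans R D (hom_functor D B) F \<beta>"
    and ex: "\<And>X. X \<in> Obj D \<Longrightarrow> exact_at (Hom D X A) (Hom D X B) (FOb F X) (\<alpha> X) (\<beta> X)"
    and surj: "\<And>X. X \<in> Obj D \<Longrightarrow> \<beta> X ` Arr D X B = carrier (FOb F X)"
    using fp by (auto simp: finitely_presented_def)
  have "exact_at (Hom D X A) (Hom D X B) (FOb G X) (\<alpha> X) (\<lambda>x. \<eta> X (\<beta> X x)) \<and>
      (\<lambda>x. \<eta> X (\<beta> X x)) ` Arr D X B = carrier (FOb G X)" if X: "X \<in> Obj D" for X
  proof
    have "\<eta> X m = \<zero>\<^bsub>FOb G X\<^esub> \<longleftrightarrow> m = \<zero>\<^bsub>FOb F X\<^esub>" if "m \<in> carrier (FOb F X)" for m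
      using bij[OF X] nat_trans_zero[OF F G \<eta> X] contravariant_functor.zero_FOb[OF F X] that
      by (metis bij_betw_def inj_on_def)
    then show "exact_at (Hom D X A) (Hom D X B) (FOb G X) (\<alpha> X) (\<lambda>x. \<eta> X (\<beta> X x))"
      using ex[OF X] nat_trans_closed[OF \<beta> X]
      by (auto simp: exact_at_def set_eq_iff a_kernel_iff)
    show "(\<lambda>x. \<eta> X (\<beta> X x)) ` Arr D X B = carrier (FOb G X)"
      using surj[OF X] bij[OF X] by (metis bij_betw_def image_image)
  qed
  then show ?thesis
    using AB \<alpha> nat_trans_comp[OF \<beta> \<eta>] unfolding finitely_presented_def by blast
qed

lemma weak_right_exact_iso:
  assumes F: "contravariant_functor R D F" and G: "contravariant_functor R D G"
    and iso: "functor_iso R D F G" and wre: "weak_right_exact D F"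
  shows "weak_right_exact D G"
  unfolding weak_right_exact_def
proof (intro allI impI)
  fix X Y Z g f assume wk: "weak_kernel_seq D X Y Z g f"
  then have o: "X \<in> Obj D" "Y \<in> Obj D" "Z \<in> Obj D" "g \<in> Arr D X Y" "f \<in> Arr D Y Z"
    by (auto simp: weak_kernel_seq_def)
  obtain \<eta> where \<eta>: "nat_trans R D F G \<eta>"
    and bij: "\<And>X. X \<in> Obj D \<Longrightarrow> bij_betw (\<eta> X) (carrier (FOb F X)) (carrier (FOb G X))"
    using iso by (auto simp: functor_iso_def)
  have img: "\<And>X. X \<in> Obj D \<Longrightarrow> carrier (FOb G X) = \<eta> X ` carrier (FOb F X)"
    using bij by (simp add: bij_betw_def)
  have "FMap F Y Z f ` carrier (FOb F Z) = a_kernel (FOb F Y) (FOb F X) (FMap F X Y g)"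
    using wre wk by (auto simp: weak_right_exact_def exact_at_def)
  then have "\<eta> Y ` FMap F Y Z f ` carrier (FOb F Z) =
      \<eta> Y ` a_kernel (FOb F Y) (FOb F X) (FMap F X Y g)" by simp
  moreover have "\<eta> Y ` FMap F Y Z f ` carrier (FOb F Z) = FMap G Y Z f ` carrier (FOb G Z)"
    unfolding img[OF o(3)] image_image
    using nat_trans_natural[OF \<eta> o(2,3,5)] by (rule image_cong[OF refl])
  moreover have "\<eta> Y ` a_kernel (FOb F Y) (FOb F X) (FMap F X Y g) =
      a_kernel (FOb G Y) (FOb G X) (FMap G X Y g)"
  proof -
    have "FMap F X Y g m = \<zero>\<^bsub>FOb F X\<^esub> \<longleftrightarrow> FMap G X Y g (\<eta> Y m) = \<zero>\<^bsub>FOb G X\<^esub>"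
      if m: "m \<in> carrier (FOb F Y)" for m
      using bij[OF o(1)] nat_trans_zero[OF F G \<eta> o(1)] contravariant_functor.zero_FOb[OF F o(1)]
        nat_trans_natural[OF \<eta> o(1,2,4) m] contravariant_functor.FMap_closed[OF F o(1,2,4) m]
      by (metis bij_betw_def inj_on_def)
    then show ?thesis
      by (auto simp: set_eq_iff a_kernel_iff img[OF o(2)])
  qed
  ultimately show "exact_at (FOb G Z) (FOb G Y) (FOb G X) (FMap G Y Z f) (FMap G X Y g)"
    by (simp add: exact_at_def)
qed

lemma (in linear_category) hom_functor_finitely_presented:
  assumes "Z \<in> Obj C"
  shows "finitely_presented R C (hom_functor C Z)"
proof -
  have z: "\<zero>\<^bsub>Hom C X Y\<^esub> \<in> Arr C X Y" if "X \<in> Obj C" "Y \<in> Obj C" for X Y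
    using Hom_module[OF that] by (meson abelian_group.axioms(1) abelian_monoid.zero_closed module.axioms(2))
  have "nat_trans R C (hom_functor C Z) (hom_functor C Z) (\<lambda>X x. Zero C X Z)"
  proof (rule nat_transI)
    fix X assume X: "X \<in> Obj C"
    interpret H: module R "Hom C X Z" by (rule Hom_module[OF X assms])
    show "linear_map R (FOb (hom_functor C Z) X) (FOb (hom_functor C Z) X) (\<lambda>x. Zero C X Z)"
      by (rule linear_mapI) auto
  next
    fix X Y f assume "X \<in> Obj C" "Y \<in> Obj C" "f \<in> Arr C X Y"
    then show "Zero C X Z = FMap (hom_functor C Z) X Y f (Zero C Y Z)"
      using linear_map_zero[OF Hom_module Hom_module Comp_linear_left] assms by simp
  qed
  moreover have "nat_trans R C (hom_functor C Z) (hom_functor C Z) (\<lambda>X x. x)"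
    by (rule nat_transI) (auto intro!: linear_mapI)
  moreover have "exact_at (Hom C X Z) (Hom C X Z) (FOb (hom_functor C Z) X) (\<lambda>x. Zero C X Z) (\<lambda>x. x)"
    if "X \<in> Obj C" for X
    using z[OF that assms] by (auto simp: exact_at_def a_kernel_iff)
  ultimately show ?thesis
    unfolding finitely_presented_def by (intro bexI[OF _ assms] exI[of _ "\<lambda>X x. Zero C X Z"] exI[of _ "\<lambda>X x. x"] conjI ballI) auto
qed


section \<open>Transport of a functor along injections\<close>

text \<open>
  Renaming the elements of a module by an injection \<open>\<iota>\<close> changes the type of its elements and nothing
  else. The operations go back along \<open>\<iota>\<close>, so they are meaningful on the image of the carrier only.
\<close>

definition transport_module :: "('m \<Rightarrow> 'n) \<Rightarrow> ('r, 'm) module \<Rightarrow> ('r, 'n) module" where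
  "transport_module \<iota> A =
     \<lparr>carrier = \<iota> ` carrier A, mult = undefined, one = undefined, zero = \<iota> \<zero>\<^bsub>A\<^esub>,
      add = (\<lambda>x y. \<iota> (inv_into (carrier A) \<iota> x \<oplus>\<^bsub>A\<^esub> inv_into (carrier A) \<iota> y)),
      smult = (\<lambda>r x. \<iota> (r \<odot>\<^bsub>A\<^esub> inv_into (carrier A) \<iota> x))\<rparr>"

definition transport_functor ::
  "('o \<Rightarrow> 'm \<Rightarrow> 'n) \<Rightarrow> ('o, 'a, 'r, 'm) mod_functor \<Rightarrow> ('o, 'a, 'r, 'n) mod_functor" where
  "transport_functor \<iota> F =
     \<lparr>FOb = (\<lambda>X. transport_module (\<iota> X) (FOb F X)),
      FMap = (\<lambda>X Y f y. \<iota> X (FMap F X Y f (inv_into (carrier (FOb F Y)) (\<iota> Y) y)))\<rparr>"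

lemma transport_module_module:
  assumes "module R A" "inj_on \<iota> (carrier A)"
  shows "module R (transport_module \<iota> A)"
proof -
  interpret A: module R A by fact
  note [simp] = inv_into_f_f[OF assms(2)]
  show ?thesis
  proof (rule moduleI)
    show "abelian_group (transport_module \<iota> A)"
    proof (rule abelian_groupI)
      fix x assume "x \<in> carrier (transport_module \<iota> A)"
      then obtain a where a: "a \<in> carrier A" "x = \<iota> a" by (auto simp: transport_module_def)
      then show "\<exists>y\<in>carrier (transport_module \<iota> A).
          y \<oplus>\<^bsub>transport_module \<iota> A\<^esub> x = \<zero>\<^bsub>transport_module \<iota> A\<^esub>"
        by (intro bexI[of _ "\<iota> (\<ominus>\<^bsub>A\<^esub> a)"]) (auto simp: transport_module_def A.l_neg)
    qed (auto simp: transport_module_def A.a_ac)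
  qed (auto simp: transport_module_def A.cring_axioms A.smult_l_distr A.smult_r_distr A.smult_assoc1
      intro: A.is_cring)
qed

lemma transport_module_linear:
  assumes "inj_on \<iota> (carrier A)"
  shows "linear_map R A (transport_module \<iota> A) \<iota>"
  using assms by (auto intro!: linear_mapI simp: transport_module_def)

lemma
  assumes F: "contravariant_functor R D F"
    and inj: "\<And>X. X \<in> Obj D \<Longrightarrow> inj_on (\<iota> X) (carrier (FOb F X))"
  shows transport_functor_contravariant: "contravariant_functor R D (transport_functor \<iota> F)"
    and transport_functor_nat_trans: "nat_trans R D F (transport_functor \<iota> F) \<iota>"
    and transport_functor_iso: "functor_iso R D F (transport_functor \<iota> F)"
proof -
  interpret contravariant_functor R D F by fact
  note [simp] = inv_into_f_f[OF inj]
  have car: "carrier (FOb (transport_functor \<iota> F) X) = \<iota> X ` carrier (FOb F X)" for X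
    by (simp add: transport_functor_def transport_module_def)
  have bij: "bij_betw (\<iota> X) (carrier (FOb F X)) (carrier (FOb (transport_functor \<iota> F) X))"
    if "X \<in> Obj D" for X
    using inj[OF that] by (simp add: car bij_betw_def)
  have lin: "linear_map R (FOb F X) (FOb (transport_functor \<iota> F) X) (\<iota> X)" if "X \<in> Obj D" for X
    using transport_module_linear[OF inj] that by (simp add: transport_functor_def)
  have linv: "linear_map R (FOb (transport_functor \<iota> F) X) (FOb F X) (inv_into (carrier (FOb F X)) (\<iota> X))"
    if "X \<in> Obj D" for X
    using that by (intro linear_map_inv_into FOb_module lin bij)
  show nt: "nat_trans R D F (transport_functor \<iota> F) \<iota>"
    by (rule nat_transI[OF lin]) (simp_all add: transport_functor_def)
  then show "functor_iso R D F (transport_functor \<iota> F)"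
    using bij by (auto simp: functor_iso_def)
  have FM: "FMap (transport_functor \<iota> F) X Y f =
      (\<lambda>y. \<iota> X (FMap F X Y f (inv_into (carrier (FOb F Y)) (\<iota> Y) y)))" for X Y f
    by (simp add: transport_functor_def)
  show "contravariant_functor R D (transport_functor \<iota> F)"
  proof (intro contravariant_functor.intro contravariant_functor_axioms.intro linear_category_axioms)
    fix X assume "X \<in> Obj D"
    then show "module R (FOb (transport_functor \<iota> F) X)"
      using transport_module_module[OF FOb_module inj] by (simp add: transport_functor_def)
  next
    fix X Y f assume "X \<in> Obj D" "Y \<in> Obj D" "f \<in> Arr D X Y"
    then show "linear_map R (FOb (transport_functor \<iota> F) Y) (FOb (transport_functor \<iota> F) X)
        (FMap (transport_functor \<iota> F) X Y f)"
      unfolding FM by (intro linear_map_comp[OF linear_map_comp[OF linv FMap_linear] lin])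
  next
    fix X Y m assume o: "X \<in> Obj D" "Y \<in> Obj D" and m: "m \<in> carrier (FOb (transport_functor \<iota> F) Y)"
    show "linear_map R (Hom D X Y) (FOb (transport_functor \<iota> F) X) (\<lambda>f. FMap (transport_functor \<iota> F) X Y f m)"
      unfolding FM
      by (rule linear_map_comp[OF functor_linear lin]) (use o m linear_map_closed[OF linv] in auto)
  qed (auto simp: FM car FMap_Ident FMap_Comp FMap_closed)
qed


section \<open>Extension of natural transformations into weak right exact functors\<close>

text \<open>
  A natural transformation on \<open>F\<close> is determined by its value on the generator \<open>s = \<pi>(1)\<close>. The
  relations of \<open>F\<close> are controlled by the injectivity of \<open>\<phi>\<close>, through a weak
  kernel of the map \<open>u = (a, e)\<close>, which presents the cokernel of \<open>\<phi>\<close>.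
\<close>

lemma weak_right_exact_extension:
  assumes D: "additive_category R D" and wk: "has_weak_kernels D"
    and F: "contravariant_functor R D F" and G: "contravariant_functor R D G"
    and M: "contravariant_functor R D M" and wre: "weak_right_exact D M"
    and \<phi>: "nat_trans R D F G \<phi>"
    and inj: "\<And>X. X \<in> Obj D \<Longrightarrow> inj_on (\<phi> X) (carrier (FOb F X))"
    and \<gamma>: "nat_trans R D F M \<gamma>"
    and E: "E \<in> Obj D" and \<pi>: "nat_trans R D (hom_functor D E) F \<pi>"
    and \<pi>_surj: "\<And>X. X \<in> Obj D \<Longrightarrow> \<pi> X ` Arr D X E = carrier (FOb F X)"
    and fp: "finitely_presented R D G"
  shows "\<exists>h. nat_trans R D G M h \<and> (\<forall>X\<in>Obj D. \<forall>x\<in>carrier (FOb F X). h X (\<phi> X x) = \<gamma> X x)"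
proof -
  interpret additive_category R D by fact
  interpret F: contravariant_functor R D F by fact
  interpret G: contravariant_functor R D G by fact
  interpret M: contravariant_functor R D M by fact
  obtain A B \<alpha> p where A: "A \<in> Obj D" and B: "B \<in> Obj D"
    and \<alpha>: "nat_trans R D (hom_functor D A) (hom_functor D B) \<alpha>"
    and p: "nat_trans R D (hom_functor D B) G p"
    and ex: "\<And>X. X \<in> Obj D \<Longrightarrow> exact_at (Hom D X A) (Hom D X B) (FOb G X) (\<alpha> X) (p X)"
    and p_surj: "\<And>X. X \<in> Obj D \<Longrightarrow> p X ` Arr D X B = carrier (FOb G X)"
    using fp by (auto simp: finitely_presented_def)
  define a where "a = \<alpha> A (Ident D A)"
  have a: "a \<in> Arr D A B"
    using nat_trans_closed[OF \<alpha> A] Ident_closed[OF A] by (simp add: a_def)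
  have p_ker: "p X x = \<zero>\<^bsub>FOb G X\<^esub> \<longleftrightarrow> (\<exists>y\<in>Arr D X A. x = Comp D X A B a y)"
    if X: "X \<in> Obj D" and x: "x \<in> Arr D X B" for X x
    using ex[OF X] x yoneda_determined[OF \<alpha> A X]
    by (auto simp: exact_at_def a_def set_eq_iff a_kernel_iff image_iff)
  define s where "s = \<pi> E (Ident D E)"
  have s: "s \<in> carrier (FOb F E)"
    using nat_trans_closed[OF \<pi> E] Ident_closed[OF E] by (simp add: s_def)
  define m where "m = \<gamma> E s"
  have m: "m \<in> carrier (FOb M E)"
    using nat_trans_closed[OF \<gamma> E s] by (simp add: m_def)
  obtain e where e: "e \<in> Arr D E B" and pe: "p E e = \<phi> E s"
    using p_surj[OF E] nat_trans_closed[OF \<phi> E s] by (metis (no_types, lifting) imageE)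
  obtain P i j pA pE where bp: "is_biproduct D A E P i j pA pE"
    using biproduct_exists[OF A E] by blast
  then have P: "P \<in> Obj D" and i: "i \<in> Arr D A P" and j: "j \<in> Arr D E P"
    and pA: "pA \<in> Arr D P A" and pE: "pE \<in> Arr D P E"
    and bp_eqs: "Comp D A P A pA i = Ident D A" "Comp D E P E pE j = Ident D E"
      "Comp D A P E pE i = Zero D A E" "Comp D E P A pA j = Zero D E A"
    by (auto simp: is_biproduct_def)
  define u where "u = Comp D P A B a pA \<oplus>\<^bsub>Hom D P B\<^esub> Comp D P E B e pE"
  interpret PB: module R "Hom D P B" by (rule Hom_module[OF P B])
  have u: "u \<in> Arr D P B"
    using P A B E a e pA pE by (simp add: u_def Comp_closed)
  have u_comp: "Comp D X P B u x =
      Comp D X A B a (Comp D X P A pA x) \<oplus>\<^bsub>Hom D X B\<^esub> Comp D X E B e (Comp D X P E pE x)"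
    if X: "X \<in> Obj D" and x: "x \<in> Arr D X P" for X x
    unfolding u_def using X x P A B E a e pA pE
    by (simp add: linear_map_add[OF Comp_linear_left] Comp_closed Comp_assoc)
  have comp_zero: "Comp D X Y Z g (Zero D X Y) = Zero D X Z"
    if "X \<in> Obj D" "Y \<in> Obj D" "Z \<in> Obj D" "g \<in> Arr D Y Z" for X Y Z g
    using that by (intro linear_map_zero[OF Hom_module Hom_module Comp_linear_right])
  have u_i: "Comp D A P B u i = a"
  proof -
    interpret AB: module R "Hom D A B" by (rule Hom_module[OF A B])
    show ?thesis using A B E a e i by (simp add: u_comp bp_eqs comp_zero Comp_Ident_right)
  qed
  have u_j: "Comp D E P B u j = e"
  proof -
    interpret EB: module R "Hom D E B" by (rule Hom_module[OF E B])
    show ?thesis using A B E a e j by (simp add: u_comp bp_eqs comp_zero Comp_Ident_right)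
  qed
  obtain K k where kseq: "weak_kernel_seq D K P B k u"
    using wk P B u unfolding has_weak_kernels_def by blast
  then have K: "K \<in> Obj D" and k: "k \<in> Arr D K P"
    and k_ex: "exact_at (Hom D K K) (Hom D K P) (Hom D K B) (\<lambda>h. Comp D K K P k h) (\<lambda>h. Comp D K P B u h)"
    by (auto simp: weak_kernel_seq_def)
  have uk: "Comp D K P B u k = Zero D K B"
  proof -
    have "k \<in> (\<lambda>h. Comp D K K P k h) ` Arr D K K"
      by (rule image_eqI[OF _ Ident_closed[OF K]]) (simp add: Comp_Ident_right[OF K P k])
    then show ?thesis
      using k_ex by (simp add: exact_at_def a_kernel_iff)
  qed
  define l where "l = Comp D K P E pE k"
  have l: "l \<in> Arr D K E" using K P E k pE by (simp add: l_def Comp_closed)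
  \<comment> \<open>Since \<open>u k = 0\<close>, the classes in \<open>G(K)\<close> of \<open>e l\<close> and of a multiple of \<open>a\<close> add up to \<open>0\<close>,
    and the second class is \<open>0\<close>.\<close>
  have sl: "FMap F K E l s = \<zero>\<^bsub>FOb F K\<^esub>"
  proof -
    interpret GK: module R "FOb G K" by (rule G.FOb_module[OF K])
    let ?y = "Comp D K P A pA k"
    have y: "?y \<in> Arr D K A" using K P A k pA by (simp add: Comp_closed)
    have c: "Comp D K A B a ?y \<in> Arr D K B" "Comp D K E B e l \<in> Arr D K B"
      using K A B E a e y l by (simp_all add: Comp_closed)
    have "\<zero>\<^bsub>FOb G K\<^esub> = p K (Comp D K P B u k)"
      using nat_trans_zero[OF hom_functor_contravariant[OF B] G p K] by (simp add: uk)
    also have "\<dots> = p K (Comp D K A B a ?y) \<oplus>\<^bsub>FOb G K\<^esub> p K (Comp D K E B e l)"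
      unfolding u_comp[OF K k] l_def[symmetric]
      using linear_map_add[OF nat_trans_linear[OF p K]] c by simp
    also have "p K (Comp D K A B a ?y) = \<zero>\<^bsub>FOb G K\<^esub>"
      using p_ker[OF K c(1)] y by blast
    finally have "p K (Comp D K E B e l) = \<zero>\<^bsub>FOb G K\<^esub>"
      using nat_trans_closed[OF p K] c(2) by simp
    then have "\<phi> K (FMap F K E l s) = \<zero>\<^bsub>FOb G K\<^esub>"
      using nat_trans_natural[OF p K E l, of e] e pe nat_trans_natural[OF \<phi> K E l s]
      by (simp add: B)
    then show ?thesis
      using inj[OF K] nat_trans_zero[OF F G \<phi> K] F.zero_FOb[OF K] F.FMap_closed[OF K E l s]
      by (metis inj_on_def)
  qed
  have ml: "FMap M K E l m = \<zero>\<^bsub>FOb M K\<^esub>"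
    using nat_trans_natural[OF \<gamma> K E l s] nat_trans_zero[OF F M \<gamma> K] by (simp add: sl m_def)
  \<comment> \<open>Under \<open>M(P) \<cong> M(A) \<times> M(E)\<close> the element \<open>w\<close> is the pair \<open>(0, m)\<close>.\<close>
  define w where "w = FMap M P E pE m"
  have w: "w \<in> carrier (FOb M P)" using M.FMap_closed[OF P E pE m] by (simp add: w_def)
  have "FMap M K P k w = \<zero>\<^bsub>FOb M K\<^esub>"
    unfolding w_def M.FMap_Comp[OF K P E k pE m, symmetric] l_def[symmetric] by (rule ml)
  then have "w \<in> FMap M P B u ` carrier (FOb M B)"
    using wre kseq w unfolding weak_right_exact_def exact_at_def by (auto simp: a_kernel_iff)
  then obtain n where n: "n \<in> carrier (FOb M B)" and wn: "w = FMap M P B u n" by blast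
  have an: "FMap M A B a n = \<zero>\<^bsub>FOb M A\<^esub>"
  proof -
    have "FMap M A B a n = FMap M A P i w"
      unfolding wn M.FMap_Comp[OF A P B i u n, symmetric] u_i ..
    also have "\<dots> = FMap M A E (Zero D A E) m"
      unfolding w_def M.FMap_Comp[OF A P E i pE m, symmetric] bp_eqs ..
    finally show ?thesis by (simp add: M.FMap_zero_arrow[OF A E m])
  qed
  have en: "FMap M E B e n = m"
  proof -
    have "FMap M E B e n = FMap M E P j w"
      unfolding wn M.FMap_Comp[OF E P B j u n, symmetric] u_j ..
    also have "\<dots> = FMap M E E (Ident D E) m"
      unfolding w_def M.FMap_Comp[OF E P E j pE m, symmetric] bp_eqs ..
    finally show ?thesis by (simp add: M.FMap_Ident[OF E m])
  qed
  have "FMap M X B x n = \<zero>\<^bsub>FOb M X\<^esub>"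
    if X: "X \<in> Obj D" and x: "x \<in> Arr D X B" and px: "p X x = \<zero>\<^bsub>FOb G X\<^esub>" for X x
  proof -
    obtain y where y: "y \<in> Arr D X A" "x = Comp D X A B a y"
      using p_ker[OF X x] px by blast
    then show ?thesis
      using M.FMap_Comp[OF X A B y(1) a n] an
        linear_map_zero[OF M.FOb_module[OF A] M.FOb_module[OF X] M.FMap_linear[OF X A y(1)]] by simp
  qed
  then obtain h where h: "nat_trans R D G M h"
    and hp: "\<And>X x. \<lbrakk>X \<in> Obj D; x \<in> Arr D X B\<rbrakk> \<Longrightarrow> h X (p X x) = FMap M X B x n"
    using nat_trans_descend[OF hom_functor_contravariant[OF B] G M p M.yoneda_nat_trans[OF B n]] p_surj
    by (auto simp del: FMap_hom_functor)
  have "h X (\<phi> X x) = \<gamma> X x" if X: "X \<in> Obj D" and x: "x \<in> carrier (FOb F X)" for X x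
  proof -
    obtain y where y: "y \<in> Arr D X E" "x = \<pi> X y"
      using \<pi>_surj[OF X] x by auto
    have xs: "x = FMap F X E y s"
      using yoneda_determined[OF \<pi> E X y(1)] y(2) by (simp add: s_def)
    have "h X (\<phi> X x) = FMap M X E y (h E (\<phi> E s))"
      using nat_trans_natural[OF \<phi> X E y(1) s] nat_trans_closed[OF \<phi> E s]
        nat_trans_natural[OF h X E y(1)] by (simp add: xs)
    also have "h E (\<phi> E s) = m"
      using hp[OF E e] by (simp add: pe en)
    also have "FMap M X E y m = \<gamma> X x"
      using nat_trans_natural[OF \<gamma> X E y(1) s] by (simp add: m_def xs)
    finally show ?thesis .
  qed
  then show ?thesis using h by blast
qed


section \<open>Monomorphisms and epimorphisms of finitely presented functors\<close>

text \<open>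
  Arrows of \<open>mod-D\<close> are extensional families; this is the extensional representative of \<open>\<eta>\<close>.
\<close>

definition restrict_nat ::
  "('o, 'a, 'r) lin_cat \<Rightarrow> ('o, 'a, 'r, 'm) mod_functor \<Rightarrow> ('o \<Rightarrow> 'm \<Rightarrow> 'n) \<Rightarrow> 'o \<Rightarrow> 'm \<Rightarrow> 'n" where
  "restrict_nat D F \<eta> = (\<lambda>X\<in>Obj D. \<lambda>x\<in>carrier (FOb F X). \<eta> X x)"

lemma restrict_nat_apply [simp]:
  "\<lbrakk>X \<in> Obj D; x \<in> carrier (FOb F X)\<rbrakk> \<Longrightarrow> restrict_nat D F \<eta> X x = \<eta> X x"
  by (simp add: restrict_nat_def)

lemma Obj_mod_cat: "F \<in> Obj (mod_cat R D) \<longleftrightarrow> contravariant_functor R D F \<and> finitely_presented R D F"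
  by (simp add: mod_cat_def)

lemma Comp_mod_cat: "Comp (mod_cat R D) F G H \<theta> \<eta> = restrict_nat D F (\<lambda>X x. \<theta> X (\<eta> X x))"
  by (simp add: mod_cat_def restrict_nat_def)

lemma Ident_mod_cat: "Ident (mod_cat R D) F = restrict_nat D F (\<lambda>X x. x)"
  by (simp add: mod_cat_def restrict_nat_def)

lemma Arr_mod_cat_nat_trans: "\<eta> \<in> Arr (mod_cat R D) F G \<Longrightarrow> nat_trans R D F G \<eta>"
  by (simp add: mod_cat_def nat_hom_def)

lemma Arr_mod_cat_ext:
  assumes "\<eta> \<in> Arr (mod_cat R D) F G" "\<theta> \<in> Arr (mod_cat R D) F G"
    and "\<And>X x. \<lbrakk>X \<in> Obj D; x \<in> carrier (FOb F X)\<rbrakk> \<Longrightarrow> \<eta> X x = \<theta> X x"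
  shows "\<eta> = \<theta>"
proof (rule PiE_ext)
  show "\<eta> \<in> (\<Pi>\<^sub>E X\<in>Obj D. carrier (FOb F X) \<rightarrow>\<^sub>E carrier (FOb G X))"
    "\<theta> \<in> (\<Pi>\<^sub>E X\<in>Obj D. carrier (FOb F X) \<rightarrow>\<^sub>E carrier (FOb G X))"
    using assms(1,2) by (simp_all add: mod_cat_def nat_hom_def)
  then have "\<eta> X \<in> carrier (FOb F X) \<rightarrow>\<^sub>E carrier (FOb G X)"
    "\<theta> X \<in> carrier (FOb F X) \<rightarrow>\<^sub>E carrier (FOb G X)" if "X \<in> Obj D" for X
    using that by (blast dest: PiE_mem)+
  then show "\<eta> X = \<theta> X" if "X \<in> Obj D" for X
    using that assms(3) by (metis PiE_ext)
qed

lemma restrict_nat_eq_iff: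
  "restrict_nat D F \<eta> = restrict_nat D F \<theta> \<longleftrightarrow>
    (\<forall>X\<in>Obj D. \<forall>x\<in>carrier (FOb F X). \<eta> X x = \<theta> X x)"
proof
  assume "restrict_nat D F \<eta> = restrict_nat D F \<theta>"
  then show "\<forall>X\<in>Obj D. \<forall>x\<in>carrier (FOb F X). \<eta> X x = \<theta> X x"
    by (metis restrict_nat_apply)
qed (auto simp: restrict_nat_def fun_eq_iff restrict_def)

lemma restrict_nat_arrow:
  assumes F: "contravariant_functor R D F" and \<eta>: "nat_trans R D F G \<eta>"
  shows "restrict_nat D F \<eta> \<in> Arr (mod_cat R D) F G"
proof -
  interpret contravariant_functor R D F by fact
  have "nat_trans R D F G (restrict_nat D F \<eta>)"
  proof (rule nat_transI)
    fix X assume X: "X \<in> Obj D"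
    interpret module R "FOb F X" by (rule FOb_module[OF X])
    note lin = nat_trans_linear[OF \<eta> X]
    show "linear_map R (FOb F X) (FOb G X) (restrict_nat D F \<eta> X)"
      by (rule linear_mapI)
        (use X in \<open>simp_all add: linear_map_closed[OF lin] linear_map_add[OF lin] linear_map_smult[OF lin]\<close>)
  qed (simp add: FMap_closed nat_trans_natural[OF \<eta>])
  then show ?thesis
    using nat_trans_closed[OF \<eta>] by (auto simp: mod_cat_def nat_hom_def restrict_nat_def)
qed

text \<open>The copy of \<open>D(-,Z)\<close> among the objects of \<open>mod-D\<close>, whose elements are sets of arrows.\<close>

abbreviation set_hom_functor :: "('o, 'a, 'r) lin_cat \<Rightarrow> 'o \<Rightarrow> ('o, 'a, 'r, 'a set) mod_functor" where
  "set_hom_functor D Z \<equiv> transport_functor (\<lambda>X x. {x}) (hom_functor D Z)"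

lemma
  assumes "linear_category R D" "Z \<in> Obj D"
  shows set_hom_functor_object: "set_hom_functor D Z \<in> Obj (mod_cat R D)"
    and set_hom_functor_to_hom: "nat_trans R D (set_hom_functor D Z) (hom_functor D Z) (\<lambda>X. the_elem)"
    and set_hom_functor_carrier: "carrier (FOb (set_hom_functor D Z) X) = (\<lambda>x. {x}) ` Arr D X Z"
proof -
  interpret linear_category R D by fact
  note H = hom_functor_contravariant[OF assms(2)]
  show car: "carrier (FOb (set_hom_functor D Z) X) = (\<lambda>x. {x}) ` Arr D X Z" for X
    by (simp add: transport_functor_def transport_module_def)
  have inj: "inj_on (\<lambda>x. {x}) (carrier (FOb (hom_functor D Z) X))" if "X \<in> Obj D" for X by simp
  note T = transport_functor_contravariant[OF H inj] and N = transport_functor_nat_trans[OF H inj]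
  show "set_hom_functor D Z \<in> Obj (mod_cat R D)"
    using T finitely_presented_iso[OF H T transport_functor_iso[OF H inj]
        hom_functor_finitely_presented[OF assms(2)]]
    by (simp add: Obj_mod_cat)
  show "nat_trans R D (set_hom_functor D Z) (hom_functor D Z) (\<lambda>X. the_elem)"
  proof (rule nat_transI)
    fix X assume X: "X \<in> Obj D"
    interpret module R "Hom D X Z" by (rule Hom_module[OF X assms(2)])
    note lin = nat_trans_linear[OF N X]
    show "linear_map R (FOb (set_hom_functor D Z) X) (FOb (hom_functor D Z) X) the_elem"
      by (rule linear_mapI)
        (auto simp: car linear_map_add[OF lin, symmetric, simplified] linear_map_smult[OF lin, symmetric, simplified])
  next
    fix X Y f y assume a: "X \<in> Obj D" "Y \<in> Obj D" "f \<in> Arr D X Y" "y \<in> carrier (FOb (set_hom_functor D Z) Y)"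
    then obtain x where x: "x \<in> Arr D Y Z" "y = {x}" by (auto simp: car)
    then show "the_elem (FMap (set_hom_functor D Z) X Y f y) = FMap (hom_functor D Z) X Y f (the_elem y)"
      using nat_trans_natural[OF N a(1-3), of x] by (simp flip: nat_trans_natural[OF N a(1-3), of x])
  qed
qed

text \<open>
  By Yoneda's lemma two elements of \<open>F(X)\<close> with the same image under \<open>\<phi>\<close> are two arrows from the copy
  of \<open>D(-,X)\<close> to \<open>F\<close> with the same composite with \<open>\<phi>\<close>.
\<close>

lemma mono_mod_cat_inj_on:
  assumes D: "linear_category R D" and F: "F \<in> Obj (mod_cat R D)" and G: "G \<in> Obj (mod_cat R D)"
    and mono: "is_mono (mod_cat R D) F G \<phi>" and X: "X \<in> Obj D"
  shows "inj_on (\<phi> X) (carrier (FOb F X))"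
proof (rule inj_onI)
  interpret linear_category R D by fact
  interpret F: contravariant_functor R D F using F by (simp add: Obj_mod_cat)
  fix x y assume x: "x \<in> carrier (FOb F X)" and y: "y \<in> carrier (FOb F X)" and eq: "\<phi> X x = \<phi> X y"
  let ?H = "set_hom_functor D X"
  have H: "?H \<in> Obj (mod_cat R D)" by (rule set_hom_functor_object[OF D X])
  have \<phi>: "nat_trans R D F G \<phi>"
    using mono Arr_mod_cat_nat_trans by (auto simp: is_mono_def)
  \<comment> \<open>\<open>t z\<close> is the arrow that corresponds to \<open>z \<in> F(X)\<close>.\<close>
  define t where "t z = restrict_nat D ?H (\<lambda>W w. FMap F W X (the_elem w) z)" for z
  have t: "t z \<in> Arr (mod_cat R D) ?H F" if "z \<in> carrier (FOb F X)" for z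
    unfolding t_def
    by (intro restrict_nat_arrow nat_trans_comp[OF set_hom_functor_to_hom[OF D X] F.yoneda_nat_trans[OF X that]])
      (use H in \<open>simp add: Obj_mod_cat\<close>)
  have "Comp (mod_cat R D) ?H F G \<phi> (t x) = Comp (mod_cat R D) ?H F G \<phi> (t y)"
    unfolding Comp_mod_cat restrict_nat_eq_iff
    using nat_trans_natural[OF \<phi> _ X] x y eq by (auto simp: t_def set_hom_functor_carrier[OF D X])
  then have "t x = t y"
    using mono H t[OF x] t[OF y] unfolding is_mono_def by blast
  then have "t x X {Ident D X} = t y X {Ident D X}" by simp
  then show "x = y"
    using X x y Ident_closed[OF X] by (simp add: t_def set_hom_functor_carrier[OF D X] F.FMap_Ident)
qed

lemma surj_is_epi_mod_cat:
  assumes \<eta>: "\<eta> \<in> Arr (mod_cat R D) F G"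
    and surj: "\<And>X. X \<in> Obj D \<Longrightarrow> \<eta> X ` carrier (FOb F X) = carrier (FOb G X)"
  shows "is_epi (mod_cat R D) F G \<eta>"
  unfolding is_epi_def
proof (intro conjI ballI impI)
  fix H \<theta> \<theta>'
  assume arr: "\<theta> \<in> Arr (mod_cat R D) G H" "\<theta>' \<in> Arr (mod_cat R D) G H"
    and "Comp (mod_cat R D) F G H \<theta> \<eta> = Comp (mod_cat R D) F G H \<theta>' \<eta>"
  then have eq: "\<theta> X (\<eta> X x) = \<theta>' X (\<eta> X x)" if "X \<in> Obj D" "x \<in> carrier (FOb F X)" for X x
    using that unfolding Comp_mod_cat restrict_nat_eq_iff by blast
  show "\<theta> = \<theta>'"
  proof (rule Arr_mod_cat_ext[OF arr])
    fix X y assume X: "X \<in> Obj D" and "y \<in> carrier (FOb G X)"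
    then obtain x where "x \<in> carrier (FOb F X)" "y = \<eta> X x" using surj by blast
    then show "\<theta> X y = \<theta>' X y" using eq[OF X] by simp
  qed
qed (rule \<eta>)

lemma weak_right_exact_is_injective:
  assumes D: "additive_category R D" and wk: "has_weak_kernels D"
    and M: "M \<in> Obj (mod_cat R D)" and wre: "weak_right_exact D M"
  shows "is_injective (mod_cat R D) M"
  unfolding is_injective_def
proof (intro conjI ballI allI impI M)
  fix F G \<phi> \<gamma>
  assume F: "F \<in> Obj (mod_cat R D)" and G: "G \<in> Obj (mod_cat R D)"
    and a: "is_mono (mod_cat R D) F G \<phi> \<and> \<gamma> \<in> Arr (mod_cat R D) F M"
  have lc: "linear_category R D" using D by (simp add: additive_category_def)
  obtain E \<pi> where E: "E \<in> Obj D" "nat_trans R D (hom_functor D E) F \<pi>"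
    "\<And>X. X \<in> Obj D \<Longrightarrow> \<pi> X ` Arr D X E = carrier (FOb F X)"
    using F by (auto simp: Obj_mod_cat finitely_presented_def)
  have \<phi>: "nat_trans R D F G \<phi>"
    using a Arr_mod_cat_nat_trans by (auto simp: is_mono_def)
  have \<gamma>: "nat_trans R D F M \<gamma>"
    using a Arr_mod_cat_nat_trans by auto
  have Fc: "contravariant_functor R D F" and Gc: "contravariant_functor R D G"
    and Mc: "contravariant_functor R D M" and Gf: "finitely_presented R D G"
    using F G M by (simp_all add: Obj_mod_cat)
  have inj: "inj_on (\<phi> X) (carrier (FOb F X))" if "X \<in> Obj D" for X
    using mono_mod_cat_inj_on[OF lc F G _ that] a by blast
  obtain h where h: "nat_trans R D G M h"
    and hg: "\<And>X x. \<lbrakk>X \<in> Obj D; x \<in> carrier (FOb F X)\<rbrakk> \<Longrightarrow> h X (\<phi> X x) = \<gamma> X x"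
    using weak_right_exact_extension[OF D wk Fc Gc Mc wre \<phi> inj \<gamma> E Gf] by blast
  show "\<exists>h\<in>Arr (mod_cat R D) G M. Comp (mod_cat R D) F G M h \<phi> = \<gamma>"
  proof
    show h': "restrict_nat D G h \<in> Arr (mod_cat R D) G M"
      by (rule restrict_nat_arrow[OF Gc h])
    have "Comp (mod_cat R D) F G M (restrict_nat D G h) \<phi> \<in> Arr (mod_cat R D) F M"
      unfolding Comp_mod_cat
      by (rule restrict_nat_arrow[OF Fc nat_trans_comp[OF \<phi> Arr_mod_cat_nat_trans[OF h']]])
    then show "Comp (mod_cat R D) F G M (restrict_nat D G h) \<phi> = \<gamma>"
      by (rule Arr_mod_cat_ext)
        (use a nat_trans_closed[OF \<phi>] in \<open>auto simp: Comp_mod_cat hg\<close>)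
  qed
qed


section \<open>Direct summands of representable functors\<close>

text \<open>
  The copy \<open>N\<close> of \<open>M\<close> in \<open>mod-D\<close> is injective, hence projective, so the epimorphism \<open>b\<close> onto \<open>N\<close> from
  the copy of \<open>D(-,B)\<close> has a section there. The section is then carried back to \<open>M\<close> and \<open>D(-,B)\<close>.
\<close>

lemma frobenius_presentation_splits:
  assumes D: "additive_category R D" and wk: "has_weak_kernels D"
    and frob: "frobenius_category R (mod_cat R D)"
    and M: "contravariant_functor R D M" and wre: "weak_right_exact D M"
    and fp: "finitely_presented R D M"
    and B: "B \<in> Obj D" and \<beta>: "nat_trans R D (hom_functor D B) M \<beta>"
    and surj: "\<And>X. X \<in> Obj D \<Longrightarrow> \<beta> X ` Arr D X B = carrier (FOb M X)"
  shows "\<exists>\<sigma>. nat_trans R D M (hom_functor D B) \<sigma> \<and>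
    (\<forall>X\<in>Obj D. \<forall>m\<in>carrier (FOb M X). \<beta> X (\<sigma> X m) = m)"
proof -
  interpret additive_category R D by fact
  \<comment> \<open>Distinct elements have disjoint nonempty fibres, as \<open>\<beta>\<close> is surjective.\<close>
  define \<iota> where "\<iota> = (\<lambda>X m. {x \<in> Arr D X B. \<beta> X x = m})"
  have inj: "inj_on (\<iota> X) (carrier (FOb M X))" if "X \<in> Obj D" for X
  proof (rule inj_onI)
    fix m n assume "m \<in> carrier (FOb M X)" "n \<in> carrier (FOb M X)" "\<iota> X m = \<iota> X n"
    then show "m = n" using surj[OF that] unfolding \<iota>_def by (auto simp: set_eq_iff image_iff) metis
  qed
  define N where "N = transport_functor \<iota> M"
  have N: "contravariant_functor R D N" and \<iota>: "nat_trans R D M N \<iota>" and iso: "functor_iso R D M N"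
    unfolding N_def
    using transport_functor_contravariant[OF M inj] transport_functor_nat_trans[OF M inj]
      transport_functor_iso[OF M inj] by blast+
  have N_carrier: "carrier (FOb N X) = \<iota> X ` carrier (FOb M X)" for X
    by (simp add: N_def transport_functor_def transport_module_def)
  have N_obj: "N \<in> Obj (mod_cat R D)"
    using N finitely_presented_iso[OF M N iso fp] by (simp add: Obj_mod_cat)
  have "is_projective (mod_cat R D) N"
    using weak_right_exact_is_injective[OF D wk N_obj weak_right_exact_iso[OF M N iso wre]]
      frobenius_category.projective_iff_injective[OF frob N_obj] by blast
  moreover
  let ?H = "set_hom_functor D B"
  define b where "b = restrict_nat D ?H (\<lambda>X y. \<iota> X (\<beta> X (the_elem y)))"
  note H = set_hom_functor_object[OF linear_category_axioms B]
    and H_carrier = set_hom_functor_carrier[OF linear_category_axioms B]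
  have b: "b \<in> Arr (mod_cat R D) ?H N"
    unfolding b_def
    by (intro restrict_nat_arrow nat_trans_comp[OF nat_trans_comp[OF set_hom_functor_to_hom \<beta>] \<iota>])
      (use H B linear_category_axioms in \<open>simp_all add: Obj_mod_cat\<close>)
  have "is_epi (mod_cat R D) ?H N b"
  proof (rule surj_is_epi_mod_cat[OF b])
    fix X assume X: "X \<in> Obj D"
    have "b X ` carrier (FOb ?H X) = \<iota> X ` \<beta> X ` Arr D X B"
      using X by (simp add: H_carrier b_def image_image)
    then show "b X ` carrier (FOb ?H X) = carrier (FOb N X)"
      by (simp add: surj[OF X] N_carrier)
  qed
  moreover have "Ident (mod_cat R D) N \<in> Arr (mod_cat R D) N N"
    unfolding Ident_mod_cat
    by (rule restrict_nat_arrow[OF N]) (auto intro!: nat_transI linear_mapI)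
  ultimately obtain s where s: "s \<in> Arr (mod_cat R D) N ?H"
    and bs: "Comp (mod_cat R D) N ?H N b s = Ident (mod_cat R D) N"
    using H N_obj unfolding is_projective_def by meson
  note s = Arr_mod_cat_nat_trans[OF s]
  let ?\<sigma> = "\<lambda>X m. the_elem (s X (\<iota> X m))"
  have "nat_trans R D M (hom_functor D B) ?\<sigma>"
    by (rule nat_trans_comp[OF nat_trans_comp[OF \<iota> s] set_hom_functor_to_hom[OF linear_category_axioms B]])
  moreover have "\<beta> X (?\<sigma> X m) = m" if X: "X \<in> Obj D" and m: "m \<in> carrier (FOb M X)" for X m
  proof -
    have im: "\<iota> X m \<in> carrier (FOb N X)" using m by (simp add: N_carrier)
    have "\<iota> X (\<beta> X (?\<sigma> X m)) = \<iota> X m"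
    proof -
      have "b X (s X (\<iota> X m)) = \<iota> X m"
        using bs X im by (simp add: Comp_mod_cat Ident_mod_cat restrict_nat_eq_iff)
      then show ?thesis
        using X nat_trans_closed[OF s X im] by (simp add: b_def)
    qed
    moreover have "?\<sigma> X m \<in> Arr D X B"
      using nat_trans_closed[OF s X im] by (auto simp: H_carrier)
    ultimately show ?thesis
      using inj[OF X] m nat_trans_closed[OF \<beta> X] by (auto dest: inj_onD)
  qed
  ultimately show ?thesis by blast
qed

text \<open>The complement of the image of \<open>\<sigma>\<close> is the kernel of its retraction: \<open>x = \<sigma>(\<beta>(x)) + (x - \<sigma>(\<beta>(x)))\<close>.\<close>

lemma split_mono_direct_summand:
  assumes M: "contravariant_functor R D M" and F: "contravariant_functor R D F"
    and \<sigma>: "nat_trans R D M F \<sigma>" and \<beta>: "nat_trans R D F M \<beta>"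
    and ret: "\<And>X m. \<lbrakk>X \<in> Obj D; m \<in> carrier (FOb M X)\<rbrakk> \<Longrightarrow> \<beta> X (\<sigma> X m) = m"
  shows "\<exists>S. is_direct_summand R D F S \<and> functor_iso R D M (subfunctor F S)"
proof -
  interpret M: contravariant_functor R D M by fact
  interpret F: contravariant_functor R D F by fact
  define S where "S = (\<lambda>X. \<sigma> X ` carrier (FOb M X))"
  define T where "T = (\<lambda>X. {x \<in> carrier (FOb F X). \<beta> X x = \<zero>\<^bsub>FOb M X\<^esub>})"
  have subm: "submodule (S X) R (FOb F X)" "submodule (T X) R (FOb F X)"
    and sum: "S X \<inter> T X = {\<zero>\<^bsub>FOb F X\<^esub>}" "S X <+>\<^bsub>FOb F X\<^esub> T X = carrier (FOb F X)"
    if X: "X \<in> Obj D" for X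
  proof -
    interpret MX: module R "FOb M X" by (rule M.FOb_module[OF X])
    interpret FX: module R "FOb F X" by (rule F.FOb_module[OF X])
    note ls = nat_trans_linear[OF \<sigma> X] and lb = nat_trans_linear[OF \<beta> X]
    note cl = linear_map_closed[OF ls] linear_map_closed[OF lb]
    note zs = nat_trans_zero[OF M F \<sigma> X] and zb = nat_trans_zero[OF F M \<beta> X]
    have neg: "\<ominus>\<^bsub>FOb F X\<^esub> x = \<zero>\<^bsub>FOb F X\<^esub> \<ominus>\<^bsub>FOb F X\<^esub> x" if "x \<in> carrier (FOb F X)" for x
      using that by (simp add: FX.minus_eq)
    show "submodule (S X) R (FOb F X)"
    proof (rule FX.submoduleI)
      show "\<zero>\<^bsub>FOb F X\<^esub> \<in> S X" unfolding S_def by (metis zs imageI MX.zero_closed)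
      fix x assume "x \<in> S X"
      then obtain m where m: "m \<in> carrier (FOb M X)" "x = \<sigma> X m" by (auto simp: S_def)
      have "\<ominus>\<^bsub>FOb F X\<^esub> x = \<sigma> X (\<zero>\<^bsub>FOb M X\<^esub> \<ominus>\<^bsub>FOb M X\<^esub> m)"
        using linear_map_minus[OF MX.module_axioms FX.module_axioms ls _ m(1)] m neg cl by (simp add: zs)
      then show "\<ominus>\<^bsub>FOb F X\<^esub> x \<in> S X" using m by (auto simp: S_def)
    next
      fix x y assume "x \<in> S X" "y \<in> S X"
      then obtain m n where "m \<in> carrier (FOb M X)" "x = \<sigma> X m" "n \<in> carrier (FOb M X)" "y = \<sigma> X n"
        by (auto simp: S_def)
      then show "x \<oplus>\<^bsub>FOb F X\<^esub> y \<in> S X"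
        using linear_map_add[OF ls, of m n, symmetric] by (auto simp: S_def)
    next
      fix r x assume r: "r \<in> carrier R" and "x \<in> S X"
      then obtain m where "m \<in> carrier (FOb M X)" "x = \<sigma> X m" by (auto simp: S_def)
      then show "r \<odot>\<^bsub>FOb F X\<^esub> x \<in> S X"
        using r linear_map_smult[OF ls, of r m, symmetric] by (auto simp: S_def)
    qed (use cl in \<open>auto simp: S_def\<close>)
    show "submodule (T X) R (FOb F X)"
    proof (rule FX.submoduleI)
      fix x assume "x \<in> T X"
      then show "\<ominus>\<^bsub>FOb F X\<^esub> x \<in> T X"
        using linear_map_minus[OF FX.module_axioms MX.module_axioms lb FX.zero_closed, of x] neg[of x]
        by (simp add: T_def zb MX.minus_eq)
    qed (auto simp: T_def zb linear_map_add[OF lb] linear_map_smult[OF lb])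
    show "S X \<inter> T X = {\<zero>\<^bsub>FOb F X\<^esub>}"
    proof
      show "S X \<inter> T X \<subseteq> {\<zero>\<^bsub>FOb F X\<^esub>}" using ret[OF X] zs by (auto simp: S_def T_def)
      show "{\<zero>\<^bsub>FOb F X\<^esub>} \<subseteq> S X \<inter> T X"
        using zb imageI[OF MX.zero_closed, of "\<sigma> X"] by (simp add: S_def T_def zs)
    qed
    show "S X <+>\<^bsub>FOb F X\<^esub> T X = carrier (FOb F X)"
    proof
      show "S X <+>\<^bsub>FOb F X\<^esub> T X \<subseteq> carrier (FOb F X)"
        using cl by (auto simp: set_add_def set_mult_def S_def T_def)
      show "carrier (FOb F X) \<subseteq> S X <+>\<^bsub>FOb F X\<^esub> T X"
      proof
        fix x assume x: "x \<in> carrier (FOb F X)"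
        define y where "y = \<sigma> X (\<beta> X x)"
        have y: "y \<in> S X" "y \<in> carrier (FOb F X)" using cl x by (auto simp: y_def S_def)
        have "\<beta> X (x \<ominus>\<^bsub>FOb F X\<^esub> y) = \<beta> X x \<ominus>\<^bsub>FOb M X\<^esub> \<beta> X x"
          using linear_map_minus[OF FX.module_axioms MX.module_axioms lb x y(2)] ret[OF X] cl x
          by (simp add: y_def)
        then have "x \<ominus>\<^bsub>FOb F X\<^esub> y \<in> T X"
          using x y cl by (simp add: T_def MX.minus_eq MX.r_neg)
        moreover have "x = y \<oplus>\<^bsub>FOb F X\<^esub> (x \<ominus>\<^bsub>FOb F X\<^esub> y)"
          using x y FX.a_lcomm[of y x "\<ominus>\<^bsub>FOb F X\<^esub> y"] by (simp add: FX.minus_eq FX.r_neg)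
        ultimately show "x \<in> S X <+>\<^bsub>FOb F X\<^esub> T X"
          using y(1) by (auto simp: set_add_def set_mult_def)
      qed
    qed
  qed
  have map_S: "FMap F X Y f ` S Y \<subseteq> S X" and map_T: "FMap F X Y f ` T Y \<subseteq> T X"
    if a: "X \<in> Obj D" "Y \<in> Obj D" "f \<in> Arr D X Y" for X Y f
  proof -
    show "FMap F X Y f ` S Y \<subseteq> S X"
    proof (rule image_subsetI)
      fix x assume "x \<in> S Y"
      then obtain m where m: "m \<in> carrier (FOb M Y)" "x = \<sigma> Y m" by (auto simp: S_def)
      have "FMap F X Y f x = \<sigma> X (FMap M X Y f m)"
        unfolding m(2) by (rule nat_trans_natural[OF \<sigma> a m(1), symmetric])
      then show "FMap F X Y f x \<in> S X"
        using M.FMap_closed[OF a m(1)] by (simp add: S_def)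
    qed
    show "FMap F X Y f ` T Y \<subseteq> T X"
      using nat_trans_natural[OF \<beta> a] F.FMap_closed[OF a]
        linear_map_zero[OF M.FOb_module[OF a(2)] M.FOb_module[OF a(1)] M.FMap_linear[OF a]]
      by (auto simp: T_def)
  qed
  have "is_subfunctor R D F S" "is_subfunctor R D F T"
    unfolding is_subfunctor_def using subm map_S map_T by simp_all
  then have "is_direct_summand R D F S"
    using sum unfolding is_direct_summand_def by simp blast
  moreover have "functor_iso R D M (subfunctor F S)"
    unfolding functor_iso_def
  proof (intro exI conjI ballI)
    show "nat_trans R D M (subfunctor F S) \<sigma>"
      using \<sigma> by (auto simp: nat_trans_def subfunctor_def linear_map_def S_def)
    show "bij_betw (\<sigma> X) (carrier (FOb M X)) (carrier (FOb (subfunctor F S) X))" if "X \<in> Obj D" for X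
      using ret[OF that] by (auto simp: bij_betw_def subfunctor_def S_def intro: inj_on_inverseI)
  qed
  ultimately show ?thesis by blast
qed

text \<open>
  The retract \<open>M\<close> of \<open>D(-,B)\<close> and the retract \<open>D(-,Y)\<close> obtained by splitting \<open>e\<close> as \<open>i p\<close> belong to the
  same idempotent \<open>\<sigma> \<beta>\<close> of \<open>D(-,B)\<close>, so \<open>p \<sigma>\<close> and \<open>\<beta> i\<close> are inverse to each other.
\<close>

lemma split_presentation_representable:
  assumes D: "linear_category R D" and kar: "karoubian D"
    and M: "contravariant_functor R D M" and B: "B \<in> Obj D"
    and \<sigma>: "nat_trans R D M (hom_functor D B) \<sigma>" and \<beta>: "nat_trans R D (hom_functor D B) M \<beta>"
    and ret: "\<And>X m. \<lbrakk>X \<in> Obj D; m \<in> carrier (FOb M X)\<rbrakk> \<Longrightarrow> \<beta> X (\<sigma> X m) = m"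
  shows "representable R D M"
proof -
  interpret linear_category R D by fact
  define e where "e = \<sigma> B (\<beta> B (Ident D B))"
  note idB = Ident_closed[OF B]
  have e: "e \<in> Arr D B B"
    using nat_trans_closed[OF \<sigma> B] nat_trans_closed[OF \<beta> B] idB by (simp add: e_def)
  have \<sigma>\<beta>: "\<sigma> X (\<beta> X x) = Comp D X B B e x" if "X \<in> Obj D" "x \<in> Arr D X B" for X x
    using yoneda_determined[OF nat_trans_comp[OF \<beta> \<sigma>] B that] by (simp add: e_def)
  have "Comp D B B B e e = e"
    using \<sigma>\<beta>[OF B e] ret[OF B nat_trans_closed[OF \<beta> B]] idB by (simp add: e_def)
  then obtain Y p i where Y: "Y \<in> Obj D" and p: "p \<in> Arr D B Y" and i: "i \<in> Arr D Y B"
    and ip: "Comp D B Y B i p = e" and pi: "Comp D Y B Y p i = Ident D Y"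
    using kar B e unfolding karoubian_def by blast
  have "nat_trans R D (hom_functor D B) (hom_functor D Y) (\<lambda>X x. Comp D X B Y p x)"
    using contravariant_functor.yoneda_nat_trans[OF hom_functor_contravariant[OF Y] B] p by simp
  then have \<eta>: "nat_trans R D M (hom_functor D Y) (\<lambda>X m. Comp D X B Y p (\<sigma> X m))"
    by (rule nat_trans_comp[OF \<sigma>])
  have "bij_betw (\<lambda>m. Comp D X B Y p (\<sigma> X m)) (carrier (FOb M X)) (Arr D X Y)" if X: "X \<in> Obj D" for X
  proof (rule bij_betwI[where g = "\<lambda>y. \<beta> X (Comp D X Y B i y)"])
    show "(\<lambda>m. Comp D X B Y p (\<sigma> X m)) \<in> carrier (FOb M X) \<rightarrow> Arr D X Y"
      using nat_trans_closed[OF \<eta> X] by auto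
    show "(\<lambda>y. \<beta> X (Comp D X Y B i y)) \<in> Arr D X Y \<rightarrow> carrier (FOb M X)"
      using nat_trans_closed[OF \<beta> X] X Y B i by (auto simp: Comp_closed)
  next
    fix m assume m: "m \<in> carrier (FOb M X)"
    then have sm: "\<sigma> X m \<in> Arr D X B" using nat_trans_closed[OF \<sigma> X] by simp
    have "Comp D X Y B i (Comp D X B Y p (\<sigma> X m)) = \<sigma> X (\<beta> X (\<sigma> X m))"
      using Comp_assoc[OF X B Y B sm p i] \<sigma>\<beta>[OF X sm] by (simp add: ip)
    then show "\<beta> X (Comp D X Y B i (Comp D X B Y p (\<sigma> X m))) = m"
      using ret[OF X m] by simp
  next
    fix y assume y: "y \<in> Arr D X Y"
    have iy: "Comp D X Y B i y \<in> Arr D X B" by (rule Comp_closed[OF X Y B y i])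
    have "Comp D X B Y p (\<sigma> X (\<beta> X (Comp D X Y B i y))) =
        Comp D X B Y p (Comp D X Y B i (Comp D X B Y p (Comp D X Y B i y)))"
      using \<sigma>\<beta>[OF X iy] Comp_assoc[OF X B Y B iy p i] by (simp add: ip)
    also have "\<dots> = y"
      using Comp_assoc[OF X Y B Y y i p] y X Y by (simp add: pi Comp_Ident_left)
    finally show "Comp D X B Y p (\<sigma> X (\<beta> X (Comp D X Y B i y))) = y" .
  qed
  then show ?thesis
    using Y \<eta> unfolding representable_def functor_iso_def by (auto intro!: bexI[of _ Y])
qed

lemma subfunctor_contravariant:
  assumes F: "contravariant_functor R D F" and S: "is_subfunctor R D F S"
  shows "contravariant_functor R D (subfunctor F S)"
proof -
  interpret contravariant_functor R D F by fact
  have sub: "submodule (S X) R (FOb F X)" if "X \<in> Obj D" for X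
    using S that by (simp add: is_subfunctor_def)
  have S_subset: "S X \<subseteq> carrier (FOb F X)" if "X \<in> Obj D" for X
    using module.submoduleE(1)[OF FOb_module[OF that] sub[OF that]] .
  have S_map: "FMap F X Y f m \<in> S X" if "X \<in> Obj D" "Y \<in> Obj D" "f \<in> Arr D X Y" "m \<in> S Y" for X Y f m
    using S that unfolding is_subfunctor_def by blast
  show ?thesis
  proof (intro contravariant_functor.intro contravariant_functor_axioms.intro linear_category_axioms)
    fix X assume "X \<in> Obj D"
    then show "module R (FOb (subfunctor F S) X)"
      using submodule.submodule_is_module[OF sub FOb_module] by (simp add: subfunctor_def)
  next
    fix X Y f assume a: "X \<in> Obj D" "Y \<in> Obj D" "f \<in> Arr D X Y"
    show "linear_map R (FOb (subfunctor F S) Y) (FOb (subfunctor F S) X) (FMap (subfunctor F S) X Y f)"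
      using FMap_linear[OF a] S_subset[OF a(2)] S_map[OF a]
      by (auto simp: linear_map_def subfunctor_def subset_iff)
  next
    fix X Y m assume a: "X \<in> Obj D" "Y \<in> Obj D" "m \<in> carrier (FOb (subfunctor F S) Y)"
    then show "linear_map R (Hom D X Y) (FOb (subfunctor F S) X) (\<lambda>f. FMap (subfunctor F S) X Y f m)"
      using functor_linear[OF a(1,2), of m] S_subset[OF a(2)] S_map[OF a(1,2)]
      by (auto simp: linear_map_def subfunctor_def)
  qed (auto simp: subfunctor_def intro!: FMap_Ident FMap_Comp subsetD[OF S_subset])
qed

text \<open>
  The decomposition of the identity of \<open>B\<close> gives the projections onto both summands: for
  \<open>x : X \<rightarrow> B\<close> the components of \<open>x\<close> are \<open>s x\<close> and \<open>t x\<close>. Hence \<open>D(-,B) \<rightarrow> D(-,B) \<rightarrow> S \<rightarrow> 0\<close>, with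
  maps \<open>t\<close> and \<open>s\<close>, is a presentation of \<open>S\<close>.
\<close>

lemma summand_of_hom_functor_finitely_presented:
  assumes D: "linear_category R D" and B: "B \<in> Obj D"
    and summand: "is_direct_summand R D (hom_functor D B) S"
  shows "finitely_presented R D (subfunctor (hom_functor D B) S)"
proof -
  interpret linear_category R D by fact
  obtain T where S: "is_subfunctor R D (hom_functor D B) S" and T: "is_subfunctor R D (hom_functor D B) T"
    and int: "\<And>X. X \<in> Obj D \<Longrightarrow> S X \<inter> T X = {Zero D X B}"
    and sum: "\<And>X. X \<in> Obj D \<Longrightarrow> S X <+>\<^bsub>Hom D X B\<^esub> T X = Arr D X B"
    using summand by (auto simp: is_direct_summand_def)
  obtain s t where s: "s \<in> S B" and t: "t \<in> T B" and st: "Ident D B = s \<oplus>\<^bsub>Hom D B B\<^esub> t"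
    using Ident_closed[OF B] unfolding sum[OF B, symmetric] by (auto simp: set_add_def set_mult_def)
  have subm: "submodule (S X) R (Hom D X B)" "submodule (T X) R (Hom D X B)" if "X \<in> Obj D" for X
    using S T that by (simp_all add: is_subfunctor_def)
  have subset: "S X \<subseteq> Arr D X B" "T X \<subseteq> Arr D X B" if "X \<in> Obj D" for X
    using module.submoduleE(1)[OF Hom_module[OF that B]] subm[OF that] by blast+
  have sB: "s \<in> Arr D B B" and tB: "t \<in> Arr D B B" using s t subset[OF B] by auto
  have sx: "Comp D X B B s x \<in> S X" and tx: "Comp D X B B t x \<in> T X"
    if "X \<in> Obj D" "x \<in> Arr D X B" for X x
    using S T s t that B unfolding is_subfunctor_def by (force simp: image_subset_iff)+
  have decomp: "x = Comp D X B B s x \<oplus>\<^bsub>Hom D X B\<^esub> Comp D X B B t x"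
    if "X \<in> Obj D" "x \<in> Arr D X B" for X x
    using linear_map_add[OF Comp_linear_left[OF that(1) B B that(2)] sB tB] Comp_Ident_left[OF that(1) B that(2)]
    by (simp add: st)
  have on_S: "Comp D X B B s x = x" if X: "X \<in> Obj D" and x: "x \<in> S X" for X x
  proof -
    interpret H: module R "Hom D X B" by (rule Hom_module[OF X B])
    have xA: "x \<in> Arr D X B" using subset[OF X] x by auto
    note c = sx[OF X xA] tx[OF X xA]
    have cA: "Comp D X B B s x \<in> Arr D X B" "Comp D X B B t x \<in> Arr D X B" using c subset[OF X] by auto
    have "Comp D X B B t x = \<ominus>\<^bsub>Hom D X B\<^esub> Comp D X B B s x \<oplus>\<^bsub>Hom D X B\<^esub> x"
      using decomp[OF X xA] cA by (metis H.r_neg1)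
    then have "Comp D X B B t x \<in> S X"
      using c x H.submoduleE(3,5)[OF subm(1)[OF X]] by simp
    then have "Comp D X B B t x = Zero D X B" using c int[OF X] by blast
    then show ?thesis using decomp[OF X xA] cA by simp
  qed
  have on_T: "Comp D X B B s x = Zero D X B" if X: "X \<in> Obj D" and x: "x \<in> T X" for X x
  proof -
    interpret H: module R "Hom D X B" by (rule Hom_module[OF X B])
    have xA: "x \<in> Arr D X B" using subset[OF X] x by auto
    note c = sx[OF X xA] tx[OF X xA]
    have cA: "Comp D X B B s x \<in> Arr D X B" "Comp D X B B t x \<in> Arr D X B" using c subset[OF X] by auto
    have "Comp D X B B s x = \<ominus>\<^bsub>Hom D X B\<^esub> Comp D X B B t x \<oplus>\<^bsub>Hom D X B\<^esub> x"
      using decomp[OF X xA] cA by (metis H.a_comm H.r_neg1)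
    then have "Comp D X B B s x \<in> T X"
      using c x H.submoduleE(3,5)[OF subm(2)[OF X]] by simp
    then show ?thesis using c int[OF X] by blast
  qed
  have \<alpha>: "nat_trans R D (hom_functor D B) (hom_functor D B) (\<lambda>X x. Comp D X B B t x)"
    using contravariant_functor.yoneda_nat_trans[OF hom_functor_contravariant[OF B] B] tB by simp
  have \<beta>: "nat_trans R D (hom_functor D B) (subfunctor (hom_functor D B) S) (\<lambda>X x. Comp D X B B s x)"
    using contravariant_functor.yoneda_nat_trans[OF
        subfunctor_contravariant[OF hom_functor_contravariant[OF B] S] B, of s] s
    by (simp add: subfunctor_def hom_functor_def)
  have "exact_at (Hom D X B) (Hom D X B) (FOb (subfunctor (hom_functor D B) S) X)
      (\<lambda>x. Comp D X B B t x) (\<lambda>x. Comp D X B B s x)" if X: "X \<in> Obj D" for X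
    unfolding exact_at_def
  proof (intro equalityI subsetI)
    interpret H: module R "Hom D X B" by (rule Hom_module[OF X B])
    fix x
    show "x \<in> a_kernel (Hom D X B) (FOb (subfunctor (hom_functor D B) S) X) (\<lambda>x. Comp D X B B s x)"
      if "x \<in> (\<lambda>x. Comp D X B B t x) ` Arr D X B"
      using that tx[OF X] on_T[OF X] subset[OF X] by (auto simp: a_kernel_iff subfunctor_def)
    assume "x \<in> a_kernel (Hom D X B) (FOb (subfunctor (hom_functor D B) S) X) (\<lambda>x. Comp D X B B s x)"
    then have x: "x \<in> Arr D X B" "Comp D X B B s x = Zero D X B"
      by (auto simp: a_kernel_iff subfunctor_def)
    then have "x = Comp D X B B t x"
      using decomp[OF X x(1)] tx[OF X x(1)] subset[OF X] by (metis H.l_zero subsetD)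
    then show "x \<in> (\<lambda>x. Comp D X B B t x) ` Arr D X B" using x(1) by blast
  qed
  moreover have "(\<lambda>x. Comp D X B B s x) ` Arr D X B = carrier (FOb (subfunctor (hom_functor D B) S) X)"
    if X: "X \<in> Obj D" for X
    using sx[OF X] on_S[OF X] subset[OF X] by (force simp: subfunctor_def image_iff)
  ultimately show ?thesis
    using B \<alpha> \<beta> unfolding finitely_presented_def by blast
qed

theorem corollary1p2:
  fixes R :: "('r, 'x) ring_scheme"
    and D :: "('o, 'a, 'r) lin_cat"
    and M :: "('o, 'a, 'r, 'm) mod_functor"
  assumes "cring R"
    and "additive_category R D"
    and "has_weak_kernels D"
    and "frobenius_category R (mod_cat R D)"
    and "contravariant_functor R D M"
    and "weak_right_exact D M"
  shows "(iso_to_summand_of_representable R D M \<longleftrightarrow> finitely_presented R D M) \<and>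
         (karoubian D \<longrightarrow> (representable R D M \<longleftrightarrow> finitely_presented R D M))"
proof -
  interpret additive_category R D by fact
  note M = assms(5)
  have summand_fp: "finitely_presented R D M" if summand: "iso_to_summand_of_representable R D M"
  proof -
    obtain B S where B: "B \<in> Obj D" and S: "is_direct_summand R D (hom_functor D B) S"
      and iso: "functor_iso R D M (subfunctor (hom_functor D B) S)"
      using summand by (auto simp: iso_to_summand_of_representable_def)
    have "contravariant_functor R D (subfunctor (hom_functor D B) S)"
      using subfunctor_contravariant[OF hom_functor_contravariant[OF B]] S
      by (simp add: is_direct_summand_def)
    then show ?thesis
      using finitely_presented_iso[OF _ M functor_iso_sym[OF M iso]]
        summand_of_hom_functor_finitely_presented[OF linear_category_axioms B S] by blast
  qed
  have repr_fp: "finitely_presented R D M" if "representable R D M"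
    using that finitely_presented_iso[OF hom_functor_contravariant M functor_iso_sym[OF M]]
      hom_functor_finitely_presented by (auto simp: representable_def)
  have splits: "\<exists>B\<in>Obj D. \<exists>\<sigma> \<beta>. nat_trans R D M (hom_functor D B) \<sigma> \<and>
      nat_trans R D (hom_functor D B) M \<beta> \<and> (\<forall>X\<in>Obj D. \<forall>m\<in>carrier (FOb M X). \<beta> X (\<sigma> X m) = m)"
    if fp: "finitely_presented R D M"
  proof -
    obtain B \<beta> where B: "B \<in> Obj D" "nat_trans R D (hom_functor D B) M \<beta>"
      "\<And>X. X \<in> Obj D \<Longrightarrow> \<beta> X ` Arr D X B = carrier (FOb M X)"
      using fp by (auto simp: finitely_presented_def)
    then show ?thesis
      using frobenius_presentation_splits[OF assms(2-4) M assms(6) fp B] by blast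
  qed
  have "iso_to_summand_of_representable R D M" if fp: "finitely_presented R D M"
  proof -
    obtain B \<sigma> \<beta> where B: "B \<in> Obj D" and "nat_trans R D M (hom_functor D B) \<sigma>"
      "nat_trans R D (hom_functor D B) M \<beta>"
      "\<And>X m. \<lbrakk>X \<in> Obj D; m \<in> carrier (FOb M X)\<rbrakk> \<Longrightarrow> \<beta> X (\<sigma> X m) = m"
      using splits[OF fp] by blast
    then show ?thesis
      using split_mono_direct_summand[OF M hom_functor_contravariant[OF B]]
      unfolding iso_to_summand_of_representable_def by blast
  qed
  moreover have "representable R D M" if "karoubian D" and fp: "finitely_presented R D M"
  proof -
    obtain B \<sigma> \<beta> where B: "B \<in> Obj D" "nat_trans R D M (hom_functor D B) \<sigma>"
      "nat_trans R D (hom_functor D B) M \<beta>"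
      "\<And>X m. \<lbrakk>X \<in> Obj D; m \<in> carrier (FOb M X)\<rbrakk> \<Longrightarrow> \<beta> X (\<sigma> X m) = m"
      using splits[OF fp] by blast
    show ?thesis
      by (rule split_presentation_representable[OF linear_category_axioms that(1) M B])
  qed
  ultimately show ?thesis using summand_fp repr_fp by blast
qed

end
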